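(* Let $U$ be an open, $O(5)$-invariant set of real antisymmetric $5\times5$ matrices, let $\mathcal V$ be a smooth real function on an open set containing $I(U)\subset\mathbb R$, where $I(\Lambda)=6\left(4\,\mathrm{tr}\,\Lambda^4-(\mathrm{tr}\,\Lambda^2)^2\right)$, and suppose that the map $$\Lambda\mapsto B(\Lambda),\qquad B_{ij}=-\Lambda_{ij}+\mathcal V'(I(\Lambda))\,\frac{\partial I}{\partial\Lambda^{ij}}$$ is a diffeomorphism of $U$ onto an open set, with inverse $B\mapsto\Lambda(B)$. Define $$\mathcal H=\frac14B_{ij}B^{ij}-\frac12\left(\Lambda_{ij}(B)+B_{ij}\right)\left(\Lambda^{ij}(B)+B^{ij}\right)+\mathcal V\left(I(\Lambda(B))\right),$$ regarded as a function $\mathcal H(s,p)$. Then at corresponding points $B\leftrightarrow\Lambda(B)$ with $s>p>0$, writing $I=I(\Lambda(B))$ and $\mathcal V_I=\mathcal V'(I)$, $$2I\,\mathcal V_I-\mathcal V(I)=s\mathcal H_s+p\mathcal H_p-\mathcal H,\qquad \frac{s^2-p^2}{p}\mathcal H_s\mathcal H_p=-2I\,\mathcal V_I,$$ and hence $$\mathcal V(I)=\mathcal H-(s\mathcal H_s+p\mathcal H_p)-\frac{s^2-p^2}{p}\mathcal H_s\mathcal H_p ;$$ moreover $$I=6\,(s^2-p^2)\left(\mathcal H_p^2-(1+\mathcal H_s)^2\right)^2 .$$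
   Context: Indices $i,j,\dots=1,\dots,5$ are raised with $\delta^{ij}$; this Euclidean 5-space is the orthogonal complement of the unit timelike vector $v^\mu$ in six-dimensional space-time, at a point. Derivatives with respect to antisymmetric matrices are antisymmetric and normalized by $\delta f=\frac{\partial f}{\partial\Lambda^{ij}}\delta\Lambda^{ij}$ (sum over all $i,j$). Explicitly $\frac{\partial I}{\partial\Lambda^{ij}}=-24\left(4(\Lambda^3)_{ij}+\Lambda_{ij}\Lambda_{kl}\Lambda^{kl}\right)$. $O(5)$ acts by conjugation. The invariants are $s=\frac14B_{ij}B^{ij}$ and $p=\sqrt{p_ip^i}$ with $p_i=\frac18\varepsilon_{ijklm}B^{jk}B^{lm}$; one has $s\ge p\ge0$. Subscripts $s,p$ denote partial derivatives. *)

theory Defs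
  imports "HOL-Analysis.Analysis"
begin

text \<open>
  The antisymmetric matrices form a proper linear subspace of the type of all matrices, so
  differentiability is taken relative to a (finite-dimensional) subspace E of the ambient space.  For S
  open in E the values f' x v with x in S and v in E are uniquely determined, and
  C_k_on k E S f is the usual k-fold continuous differentiability of f on the open subset
  S of E.  For E = UNIV this is the notion for open subsets of the whole space.
\<close>

primrec C_k_on ::
  "nat \<Rightarrow> 'a::real_normed_vector set \<Rightarrow> 'a set \<Rightarrow> ('a \<Rightarrow> 'b::real_normed_vector) \<Rightarrow> bool"
where
  "C_k_on 0 E S f \<longleftrightarrow> continuous_on S f"
| "C_k_on (Suc k) E S f \<longleftrightarrow>
     (\<exists>f'. (\<forall>x\<in>S. (f has_derivative f' x) (at x within S)) \<and>
           (\<forall>v\<in>E. C_k_on k E S (\<lambda>x. f' x v)))"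

definition smooth_on ::
  "'a::real_normed_vector set \<Rightarrow> 'a set \<Rightarrow> ('a \<Rightarrow> 'b::real_normed_vector) \<Rightarrow> bool"
  where "smooth_on E S f \<longleftrightarrow> (\<forall>k. C_k_on k E S f)"

definition diffeomorphism_on ::
  "'a::real_normed_vector set \<Rightarrow> 'a set \<Rightarrow> 'a set \<Rightarrow> ('a \<Rightarrow> 'a) \<Rightarrow> bool"
  where "diffeomorphism_on E S T f \<longleftrightarrow>
     openin (top_of_set E) S \<and> openin (top_of_set E) T \<and> bij_betw f S T \<and>
     smooth_on E S f \<and> smooth_on E T (inv_into S f)"

definition skew :: "(real^'n^'n) set"
  where "skew = {A. transpose A = - A}"

definition orthogonally_invariant :: "(real^'n^'n) set \<Rightarrow> bool"
  where "orthogonally_invariant U \<longleftrightarrow>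
     (\<forall>A\<in>U. \<forall>Q. orthogonal_matrix Q \<longrightarrow> Q ** A ** transpose Q \<in> U)"

text \<open>
  The inner product \<open>A \<bullet> B\<close> of two matrices is the sum of \<open>A $ i $ j * B $ i $ j\<close>
  over all \<open>i\<close> and \<open>j\<close>.
\<close>

definition skew_gradient :: "(real^'n^'n \<Rightarrow> real) \<Rightarrow> real^'n^'n \<Rightarrow> real^'n^'n"
  where "skew_gradient f A =
     (THE G. G \<in> skew \<and> (f has_derivative (\<lambda>X. G \<bullet> X)) (at A within skew))"

definition inv_I :: "real^5^5 \<Rightarrow> real"
  where "inv_I L = 6 * (4 * trace (L ** L ** L ** L) - (trace (L ** L))\<^sup>2)"

text \<open>In the index type 5 arithmetic is modulo 5; its elements are 1, 2, 3, 4 and 5 = 0.\<close>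

definition levi_civita :: "5 \<Rightarrow> 5 \<Rightarrow> 5 \<Rightarrow> 5 \<Rightarrow> 5 \<Rightarrow> real"
  where "levi_civita i j k l m =
     (let \<pi> = (\<lambda>x::5. if x = 1 then i else if x = 2 then j else if x = 3 then k
                       else if x = 4 then l else m)
      in if bij \<pi> then of_int (sign \<pi>) else 0)"

definition inv_s :: "real^5^5 \<Rightarrow> real"
  where "inv_s B = 1/4 * (B \<bullet> B)"

definition p_vec :: "real^5^5 \<Rightarrow> real^5"
  where "p_vec B =
     (\<chi> i. 1/8 * (\<Sum>j\<in>UNIV. \<Sum>k\<in>UNIV. \<Sum>l\<in>UNIV. \<Sum>m\<in>UNIV.
                  levi_civita i j k l m * B $ j $ k * B $ l $ m))"

definition inv_p :: "real^5^5 \<Rightarrow> real"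
  where "inv_p B = sqrt (\<Sum>i\<in>UNIV. (p_vec B $ i)\<^sup>2)"

definition B_map :: "(real \<Rightarrow> real) \<Rightarrow> real^5^5 \<Rightarrow> real^5^5"
  where "B_map V L = - L + deriv V (inv_I L) *\<^sub>R skew_gradient inv_I L"

definition Lambda_of :: "(real \<Rightarrow> real) \<Rightarrow> (real^5^5) set \<Rightarrow> real^5^5 \<Rightarrow> real^5^5"
  where "Lambda_of V U = inv_into U (B_map V)"

definition hamiltonian :: "(real \<Rightarrow> real) \<Rightarrow> (real^5^5) set \<Rightarrow> real^5^5 \<Rightarrow> real"
  where "hamiltonian V U B =
     (let L = Lambda_of V U B
      in 1/4 * (B \<bullet> B) - 1/2 * ((L + B) \<bullet> (L + B)) + V (inv_I L))"

definition represents_hamiltonian ::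
  "(real \<Rightarrow> real) \<Rightarrow> (real^5^5) set \<Rightarrow> (real^5^5) set \<Rightarrow> (real \<Rightarrow> real \<Rightarrow> real) \<Rightarrow> bool"
  where "represents_hamiltonian V U T H \<longleftrightarrow>
     (\<forall>B\<in>T. hamiltonian V U B = H (inv_s B) (inv_p B))"

end

theory Submission
  imports Defs
begin

text \<open>
  The invariant \<open>p\<^sup>2\<close> is the polynomial \<open>s\<^sup>2 - I(B) / 96\<close>, so \<open>s\<close> and \<open>p\<close> depend only on the \<open>O(5)\<close> orbit,
  and they separate orbits: every skew \<open>5 \<times> 5\<close> matrix is conjugate to a block diagonal matrix
  with blocks \<open>a J\<close>, \<open>b J\<close>, \<open>0\<close>, where \<open>a \<ge> b \<ge> 0\<close> are functions of \<open>s\<close> and \<open>p\<close>.  The normal form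
  comes from maximising \<open>Q \<mapsto> Q B Q\<^sup>T \<bullet> N\<close> over \<open>O(5)\<close> for a generic block diagonal \<open>N\<close>: at a
  maximum, \<open>Q B Q\<^sup>T\<close> commutes with \<open>N\<close>.

  As \<open>\<Lambda>\<close> commutes with \<open>B(\<Lambda>)\<close>, both are block diagonal together when \<open>s > p > 0\<close>.  The
  Legendre structure cancels the derivative of \<open>\<Lambda>(B)\<close> in \<open>dH = - (\<Lambda> + B / 2) \<bullet> dB\<close>, which
  expresses \<open>H\<^sub>s\<close> and \<open>H\<^sub>p\<close> through the skew eigenvalues of \<open>\<Lambda>\<close> and \<open>B\<close>; the identities
  are then algebraic.
\<close>

subsection \<open>The Levi-Civita symbol and the invariant \<open>p\<close>\<close>

lemma exhaust_5:
  fixes x :: 5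
  shows "x = 1 \<or> x = 2 \<or> x = 3 \<or> x = 4 \<or> x = 5"
proof (induct x)
  case (of_int z)
  then have "z = 0 \<or> z = 1 \<or> z = 2 \<or> z = 3 \<or> z = 4" by fastforce
  then show ?case by auto
qed

lemma forall_5: "(\<forall>i::5. P i) \<longleftrightarrow> P 1 \<and> P 2 \<and> P 3 \<and> P 4 \<and> P 5"
  by (metis exhaust_5)

lemma UNIV_5: "UNIV = {1, 2, 3, 4, 5::5}"
  using exhaust_5 by auto

lemma sum_5: "sum f (UNIV::5 set) = f 1 + f 2 + f 3 + f 4 + f 5"
  unfolding UNIV_5 by (simp add: ac_simps)

lemma levi_civita_repeated:
  assumes "\<not> distinct [i, j, k, l, m]"
  shows "levi_civita i j k l m = 0"
proof -
  define f where "f = (\<lambda>x::5. if x = 1 then i else if x = 2 then j else if x = 3 then k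
                       else if x = 4 then l else m)"
  have "f 1 = i" "f 2 = j" "f 3 = k" "f 4 = l" "f 5 = m" by (simp_all add: f_def)
  then have eqs: "i = f 1" "j = f 2" "k = f 3" "l = f 4" "m = f 5" by simp_all
  have "distinct [i, j, k, l, m]" if "bij f"
    unfolding eqs by (simp add: inj_eq[OF bij_is_inj[OF that]])
  then show ?thesis using assms by (auto simp: levi_civita_def f_def[symmetric] simp del: distinct.simps)
qed

lemma sign_comp_transposition:
  fixes f :: "'a::finite \<Rightarrow> 'a"
  assumes "bij f" "a \<noteq> b"
  shows "sign (f \<circ> Transposition.transpose a b) = - sign f"
  using assms
  by (simp add: sign_compose sign_swap_id permutation_swap_id permutation)

text \<open>Exchanging adjacent indices precomposes the index map with a transposition, which
  preserves bijectivity and flips the sign.\<close>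

lemma levi_civita_swap:
  "levi_civita j i k l m = - levi_civita i j k l m"
  "levi_civita i k j l m = - levi_civita i j k l m"
  "levi_civita i j l k m = - levi_civita i j k l m"
  "levi_civita i j k m l = - levi_civita i j k l m"
proof -
  let ?f = "\<lambda>i j k l m. \<lambda>x::5. if x = 1 then i else if x = 2 then j else if x = 3 then k
                       else if x = 4 then l else m"
  have *: "(if bij g then of_int (sign g) else 0) = - (if bij f then of_int (sign f) else (0::real))"
    if "g = f \<circ> Transposition.transpose a b" "a \<noteq> b" for f g :: "5 \<Rightarrow> 5" and a b
  proof -
    have tr: "bij (Transposition.transpose a b)"
      by (rule o_bij[where g = "Transposition.transpose a b"]) simp_all
    have f: "f = g \<circ> Transposition.transpose a b"
      by (simp add: that(1) comp_assoc)
    have "bij g" if "bij f"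
      unfolding \<open>g = _\<close> using that by (intro bij_comp tr)
    moreover have "bij f" if "bij g"
      unfolding f using that by (intro bij_comp tr)
    ultimately show ?thesis
      unfolding \<open>g = _\<close> using sign_comp_transposition[of f a b] \<open>a \<noteq> b\<close> by (auto simp: that(1))
  qed
  have 1: "?f j i k l m = ?f i j k l m \<circ> Transposition.transpose 1 2"
   and 2: "?f i k j l m = ?f i j k l m \<circ> Transposition.transpose 2 3"
   and 3: "?f i j l k m = ?f i j k l m \<circ> Transposition.transpose 3 4"
   and 4: "?f i j k m l = ?f i j k l m \<circ> Transposition.transpose 4 5"
    by (auto simp: fun_eq_iff forall_5)
  show "levi_civita j i k l m = - levi_civita i j k l m"
    unfolding levi_civita_def Let_def by (rule *[OF 1]) simp
  show "levi_civita i k j l m = - levi_civita i j k l m"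
    unfolding levi_civita_def Let_def by (rule *[OF 2]) simp
  show "levi_civita i j l k m = - levi_civita i j k l m"
    unfolding levi_civita_def Let_def by (rule *[OF 3]) simp
  show "levi_civita i j k m l = - levi_civita i j k l m"
    unfolding levi_civita_def Let_def by (rule *[OF 4]) simp
qed

lemma levi_civita_12345: "levi_civita 1 2 3 4 5 = 1"
proof -
  have "(\<lambda>x::5. if x = 1 then 1 else if x = 2 then 2 else if x = 3 then 3
                       else if x = 4 then 4 else 5) = id"
    by (auto simp: fun_eq_iff forall_5)
  then show ?thesis by (simp add: levi_civita_def)
qed

text \<open>Only instances whose left side is out of order at the swapped places: as rewrite rules
  they bubble-sort numeral indices and terminate, whereas the general equations undo
  themselves.\<close>

lemmas levi_civita_sort =
  levi_civita_swap(1)[where j = 2 and i = 1]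
  levi_civita_swap(1)[where j = 3 and i = 1]
  levi_civita_swap(1)[where j = 3 and i = 2]
  levi_civita_swap(1)[where j = 4 and i = 1]
  levi_civita_swap(1)[where j = 4 and i = 2]
  levi_civita_swap(1)[where j = 4 and i = 3]
  levi_civita_swap(1)[where j = 5 and i = 1]
  levi_civita_swap(1)[where j = 5 and i = 2]
  levi_civita_swap(1)[where j = 5 and i = 3]
  levi_civita_swap(1)[where j = 5 and i = 4]
  levi_civita_swap(2)[where k = 2 and j = 1]
  levi_civita_swap(2)[where k = 3 and j = 1]
  levi_civita_swap(2)[where k = 3 and j = 2]
  levi_civita_swap(2)[where k = 4 and j = 1]
  levi_civita_swap(2)[where k = 4 and j = 2]
  levi_civita_swap(2)[where k = 4 and j = 3]
  levi_civita_swap(2)[where k = 5 and j = 1]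
  levi_civita_swap(2)[where k = 5 and j = 2]
  levi_civita_swap(2)[where k = 5 and j = 3]
  levi_civita_swap(2)[where k = 5 and j = 4]
  levi_civita_swap(3)[where l = 2 and k = 1]
  levi_civita_swap(3)[where l = 3 and k = 1]
  levi_civita_swap(3)[where l = 3 and k = 2]
  levi_civita_swap(3)[where l = 4 and k = 1]
  levi_civita_swap(3)[where l = 4 and k = 2]
  levi_civita_swap(3)[where l = 4 and k = 3]
  levi_civita_swap(3)[where l = 5 and k = 1]
  levi_civita_swap(3)[where l = 5 and k = 2]
  levi_civita_swap(3)[where l = 5 and k = 3]
  levi_civita_swap(3)[where l = 5 and k = 4]
  levi_civita_swap(4)[where m = 2 and l = 1]
  levi_civita_swap(4)[where m = 3 and l = 1]
  levi_civita_swap(4)[where m = 3 and l = 2]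
  levi_civita_swap(4)[where m = 4 and l = 1]
  levi_civita_swap(4)[where m = 4 and l = 2]
  levi_civita_swap(4)[where m = 4 and l = 3]
  levi_civita_swap(4)[where m = 5 and l = 1]
  levi_civita_swap(4)[where m = 5 and l = 2]
  levi_civita_swap(4)[where m = 5 and l = 3]
  levi_civita_swap(4)[where m = 5 and l = 4]

lemma levi_civita_repeated_simps:
  "levi_civita i i k l m = 0" "levi_civita i j i l m = 0" "levi_civita i j k i m = 0"
  "levi_civita i j k l i = 0" "levi_civita i j j l m = 0" "levi_civita i j k j m = 0"
  "levi_civita i j k l j = 0" "levi_civita i j k k m = 0" "levi_civita i j k l k = 0"
  "levi_civita i j k l l = 0"
  by (simp_all add: levi_civita_repeated)

lemma skew_iff: "A \<in> skew \<longleftrightarrow> (\<forall>i j. A $ j $ i = - A $ i $ j)"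
  by (auto simp only: skew_def transpose_def vec_eq_iff mem_Collect_eq vec_lambda_beta vector_uminus_component)

lemma skew_nth: "A \<in> skew \<Longrightarrow> A $ j $ i = - A $ i $ j"
  unfolding skew_iff by blast

lemma skew_nth_same: "A \<in> skew \<Longrightarrow> A $ i $ i = 0" for A :: "real^'n^'n"
  using skew_nth[of A i i] by linarith

text \<open>Up to sign, component \<open>i\<close> is the Pfaffian of the submatrix without row and
  column \<open>i\<close>. Each of its three products occurs eight times in the sum, which the
  factor \<open>1/8\<close> cancels.\<close>

lemma p_vec_nth:
  assumes "B \<in> skew"
  shows "p_vec B $ 1 = B$2$3 * B$4$5 - B$2$4 * B$3$5 + B$2$5 * B$3$4"
    and "p_vec B $ 2 = - (B$1$3 * B$4$5 - B$1$4 * B$3$5 + B$1$5 * B$3$4)"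
    and "p_vec B $ 3 = B$1$2 * B$4$5 - B$1$4 * B$2$5 + B$1$5 * B$2$4"
    and "p_vec B $ 4 = - (B$1$2 * B$3$5 - B$1$3 * B$2$5 + B$1$5 * B$2$3)"
    and "p_vec B $ 5 = B$1$2 * B$3$4 - B$1$3 * B$2$4 + B$1$4 * B$2$3"
proof -
  have B: "B$2$1 = - B$1$2" "B$3$1 = - B$1$3" "B$4$1 = - B$1$4" "B$5$1 = - B$1$5"
    "B$3$2 = - B$2$3" "B$4$2 = - B$2$4" "B$5$2 = - B$2$5"
    "B$4$3 = - B$3$4" "B$5$3 = - B$3$5" "B$5$4 = - B$4$5"
    by (rule skew_nth[OF assms])+
  show "p_vec B $ 1 = B$2$3 * B$4$5 - B$2$4 * B$3$5 + B$2$5 * B$3$4"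
    by (simp add: p_vec_def sum_5 levi_civita_repeated_simps levi_civita_sort levi_civita_12345 B)
  show "p_vec B $ 2 = - (B$1$3 * B$4$5 - B$1$4 * B$3$5 + B$1$5 * B$3$4)"
    by (simp add: p_vec_def sum_5 levi_civita_repeated_simps levi_civita_sort levi_civita_12345 B)
  show "p_vec B $ 3 = B$1$2 * B$4$5 - B$1$4 * B$2$5 + B$1$5 * B$2$4"
    by (simp add: p_vec_def sum_5 levi_civita_repeated_simps levi_civita_sort levi_civita_12345 B)
  show "p_vec B $ 4 = - (B$1$2 * B$3$5 - B$1$3 * B$2$5 + B$1$5 * B$2$3)"
    by (simp add: p_vec_def sum_5 levi_civita_repeated_simps levi_civita_sort levi_civita_12345 B)
  show "p_vec B $ 5 = B$1$2 * B$3$4 - B$1$3 * B$2$4 + B$1$4 * B$2$3"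
    by (simp add: p_vec_def sum_5 levi_civita_repeated_simps levi_civita_sort levi_civita_12345 B)
qed

subsection \<open>Orthogonal conjugation\<close>

lemma matrix_nth: "(A ** B) $ i $ j = (\<Sum>k\<in>UNIV. A $ i $ k * B $ k $ j)"
  for A B :: "real^'n^'n"
  by (simp add: matrix_matrix_mult_def)

lemma inner_matrix_eq_trace: "A \<bullet> B = trace (transpose A ** B)" for A B :: "real^'n^'n"
  unfolding inner_vec_def trace_def matrix_nth transpose_def
  by (simp add: sum.swap[of "\<lambda>i j. A $ i $ j * B $ i $ j"])

lemma inner_skew_left: "A \<in> skew \<Longrightarrow> A \<bullet> B = - trace (A ** B)" for A B :: "real^'n^'n"
  by (simp add: inner_matrix_eq_trace skew_def trace_def matrix_nth sum_negf)

lemma matrix_add_rdistrib: "(A + B) ** C = A ** C + B ** C" for A B C :: "real^'n^'n"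
  by (simp add: vec_eq_iff matrix_nth distrib_right sum.distrib)

lemma bounded_bilinear_matrix_mult:
  "bounded_bilinear ((**) :: real^'n^'n \<Rightarrow> real^'n^'n \<Rightarrow> real^'n^'n)"
  unfolding bilinear_conv_bounded_bilinear[symmetric] bilinear_def
  by (auto intro!: linearI simp: matrix_add_ldistrib matrix_add_rdistrib
      vec_eq_iff matrix_nth sum_distrib_left ac_simps)

lemmas matrix_minus_left = bounded_bilinear.minus_left[OF bounded_bilinear_matrix_mult]
  and matrix_minus_right = bounded_bilinear.minus_right[OF bounded_bilinear_matrix_mult]
  and matrix_diff_left = bounded_bilinear.diff_left[OF bounded_bilinear_matrix_mult]
  and matrix_diff_right = bounded_bilinear.diff_right[OF bounded_bilinear_matrix_mult]
  and matrix_scaleR_left = bounded_bilinear.scaleR_left[OF bounded_bilinear_matrix_mult]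
  and matrix_scaleR_right = bounded_bilinear.scaleR_right[OF bounded_bilinear_matrix_mult]

lemma bounded_linear_trace: "bounded_linear (trace :: real^'n^'n \<Rightarrow> real)"
  unfolding linear_conv_bounded_linear[symmetric]
  by (auto intro!: linearI simp: trace_def sum.distrib sum_distrib_left)

lemma trace_scaleR: "trace (c *\<^sub>R A) = c * trace A" for A :: "real^'n^'n"
  by (simp add: trace_def sum_distrib_left)

lemma trace_uminus: "trace (- A) = - trace A" for A :: "real^'n^'n"
  by (simp add: trace_def sum_negf)

lemma transpose_uminus: "transpose (- A) = - transpose A" for A :: "real^'n^'n"
  by (simp add: transpose_def vec_eq_iff)

lemma transpose_add: "transpose (A + B) = transpose A + transpose B" for A B :: "real^'n^'n"
  by (simp add: transpose_def vec_eq_iff)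

lemma transpose_matrix_diff: "transpose (A - B) = transpose A - transpose B" for A B :: "real^'n^'n"
  by (simp add: transpose_def vec_eq_iff)

text \<open>The square of a skew matrix is symmetric, so the quartic trace is the squared norm of
  \<open>B ** B\<close>, and only one matrix product has to be expanded.\<close>

lemma trace_quartic_skew:
  fixes B :: "real^'n^'n"
  assumes "B \<in> skew"
  shows "trace (B ** B ** B ** B) = (\<Sum>i\<in>UNIV. \<Sum>j\<in>UNIV. ((B ** B) $ i $ j)\<^sup>2)"
proof -
  have "transpose (B ** B) = B ** B"
    using assms by (simp add: skew_def matrix_transpose_mul matrix_minus_left matrix_minus_right)
  then have "trace (B ** B ** B ** B) = (B ** B) \<bullet> (B ** B)"
    by (simp add: inner_matrix_eq_trace matrix_mul_assoc)
  then show ?thesis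
    by (simp add: inner_vec_def power2_eq_square)
qed

text \<open>A polynomial identity in the ten entries above the diagonal. It expresses
  \<open>p\<close> through \<open>inv_s\<close> and \<open>inv_I\<close>, whose invariance under
  conjugation is immediate, so no transformation law for the Levi-Civita symbol enters.\<close>

lemma p_vec_norm_sq:
  assumes "B \<in> skew"
  shows "(\<Sum>i\<in>UNIV. (p_vec B $ i)\<^sup>2) = (inv_s B)\<^sup>2 - inv_I B / 96"
proof -
  have B: "B$2$1 = - B$1$2" "B$3$1 = - B$1$3" "B$4$1 = - B$1$4" "B$5$1 = - B$1$5"
    "B$3$2 = - B$2$3" "B$4$2 = - B$2$4" "B$5$2 = - B$2$5"
    "B$4$3 = - B$3$4" "B$5$3 = - B$3$5" "B$5$4 = - B$4$5"
    by (rule skew_nth[OF assms])+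
  have tr: "trace (B ** B) = - (B \<bullet> B)"
    using inner_skew_left[OF assms, of B] by simp
  have q: "B \<bullet> B = 2 * ((B$1$2)\<^sup>2 + (B$1$3)\<^sup>2 + (B$1$4)\<^sup>2 + (B$1$5)\<^sup>2 + (B$2$3)\<^sup>2
      + (B$2$4)\<^sup>2 + (B$2$5)\<^sup>2 + (B$3$4)\<^sup>2 + (B$3$5)\<^sup>2 + (B$4$5)\<^sup>2)"
    by (simp add: inner_vec_def sum_5 B skew_nth_same[OF assms] power2_eq_square)
  show ?thesis
    unfolding inv_I_def inv_s_def trace_quartic_skew[OF assms] tr q
    by (simp add: sum_5 p_vec_nth[OF assms] matrix_nth B skew_nth_same[OF assms])
       algebra
qed

lemma orthogonal_conj_mult:
  fixes A B :: "real^'n^'n"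
  assumes "orthogonal_matrix Q"
  shows "(Q ** A ** transpose Q) ** (Q ** B ** transpose Q) = Q ** (A ** B) ** transpose Q"
proof -
  have "(Q ** A ** transpose Q) ** (Q ** B ** transpose Q)
      = Q ** A ** (transpose Q ** Q) ** B ** transpose Q"
    by (simp add: matrix_mul_assoc)
  moreover have "transpose Q ** Q = mat 1"
    using assms by (simp add: orthogonal_matrix)
  ultimately show ?thesis
    by (simp only: matrix_mul_rid) (simp add: matrix_mul_assoc)
qed

lemma trace_orthogonal_conj:
  fixes A :: "real^'n^'n"
  assumes "orthogonal_matrix Q"
  shows "trace (Q ** A ** transpose Q) = trace A"
  using assms trace_mul_sym[of "Q ** A" "transpose Q"]
  by (simp add: orthogonal_matrix matrix_mul_assoc)

lemma transpose_conj: "transpose (Q ** A ** transpose Q) = Q ** transpose A ** transpose Q"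
  for A :: "real^'n^'n"
  by (simp add: matrix_transpose_mul matrix_mul_assoc)

lemma inner_orthogonal_conj:
  fixes A B :: "real^'n^'n"
  assumes "orthogonal_matrix Q"
  shows "(Q ** A ** transpose Q) \<bullet> (Q ** B ** transpose Q) = A \<bullet> B"
  by (simp add: inner_matrix_eq_trace transpose_conj orthogonal_conj_mult trace_orthogonal_conj assms)

lemma skew_orthogonal_conj:
  fixes A Q :: "real^'n^'n"
  assumes "A \<in> skew"
  shows "Q ** A ** transpose Q \<in> skew"
  using assms by (simp add: skew_def transpose_conj matrix_minus_left matrix_minus_right)

lemma orthogonal_conj_inverse:
  fixes A :: "real^'n^'n"
  assumes "orthogonal_matrix Q"
  shows "transpose Q ** (Q ** A ** transpose Q) ** Q = A"
proof -
  have "transpose Q ** (Q ** A ** transpose Q) ** Q = (transpose Q ** Q) ** A ** (transpose Q ** Q)"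
    by (simp add: matrix_mul_assoc)
  then show ?thesis
    using assms by (simp add: orthogonal_matrix)
qed

lemma inv_I_orthogonal_conj:
  assumes "orthogonal_matrix Q"
  shows "inv_I (Q ** A ** transpose Q) = inv_I A"
  unfolding inv_I_def by (simp only: orthogonal_conj_mult trace_orthogonal_conj assms)

lemma inv_s_orthogonal_conj:
  assumes "orthogonal_matrix Q"
  shows "inv_s (Q ** A ** transpose Q) = inv_s A"
  by (simp add: inv_s_def inner_orthogonal_conj assms)

lemma inv_p_orthogonal_conj:
  assumes "orthogonal_matrix Q" "A \<in> skew"
  shows "inv_p (Q ** A ** transpose Q) = inv_p A"
  by (simp add: inv_p_def p_vec_norm_sq skew_orthogonal_conj inv_s_orthogonal_conj
      inv_I_orthogonal_conj assms)

subsection \<open>Normal form of skew \<open>5 \<times> 5\<close> matrices\<close>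

definition blk :: "real \<Rightarrow> real \<Rightarrow> real^5^5"
  where "blk a b = (\<chi> i j. if i = 1 \<and> j = 2 then a else if i = 2 \<and> j = 1 then - a
     else if i = 3 \<and> j = 4 then b else if i = 4 \<and> j = 3 then - b else 0)"

lemma blk_eq_scaleR: "blk a b = a *\<^sub>R blk 1 0 + b *\<^sub>R blk 0 1"
  by (simp add: blk_def vec_eq_iff)

lemma blk_skew: "blk a b \<in> skew"
  by (auto simp: skew_iff blk_def)

lemma inner_blk: "blk a b \<bullet> blk c d = 2 * (a * c + b * d)"
  by (simp add: blk_def inner_vec_def sum_5)

lemma inv_s_blk: "inv_s (blk a b) = (a\<^sup>2 + b\<^sup>2) / 2"
  by (simp add: inv_s_def inner_blk power2_eq_square)

lemma inv_p_blk: "inv_p (blk a b) = \<bar>a * b\<bar>"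
  by (simp add: inv_p_def sum_5 p_vec_nth[OF blk_skew]) (simp add: blk_def)

lemma inv_I_blk: "inv_I (blk a b) = 24 * (a\<^sup>2 - b\<^sup>2)\<^sup>2"
proof -
  have "(\<Sum>i\<in>UNIV. (p_vec (blk a b) $ i)\<^sup>2) = (a * b)\<^sup>2"
    by (simp add: sum_5 p_vec_nth[OF blk_skew]) (simp add: blk_def)
  with p_vec_norm_sq[OF blk_skew, of a b] show ?thesis
    unfolding inv_s_blk by (simp add: field_simps power2_eq_square)
qed

text \<open>\<open>C\<close> preserves the eigenspaces of the square of \<open>blk a b\<close>, with
  eigenvalues \<open>- a\<^sup>2\<close> on the first plane, \<open>- b\<^sup>2\<close> on the
  second and 0 on the fifth axis. These are distinct, and a skew map of a plane is a multiple of its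
  rotation generator.\<close>

lemma commute_blk:
  assumes "C \<in> skew" and comm: "C ** blk a b = blk a b ** C"
    and "a \<noteq> 0" "b \<noteq> 0" "a\<^sup>2 \<noteq> b\<^sup>2"
  shows "C = blk (C $ 1 $ 2) (C $ 3 $ 4)"
proof -
  have *: "(C ** blk a b) $ i $ j = (blk a b ** C) $ i $ j" for i j
    by (simp add: comm)
  have "C$2$1 = - C$1$2" "C$3$1 = - C$1$3" "C$4$1 = - C$1$4" "C$5$1 = - C$1$5"
    "C$3$2 = - C$2$3" "C$4$2 = - C$2$4" "C$5$2 = - C$2$5"
    "C$4$3 = - C$3$4" "C$5$3 = - C$3$5" "C$5$4 = - C$4$5"
    by (rule skew_nth[OF \<open>C \<in> skew\<close>])+
  note C = this skew_nth_same[OF \<open>C \<in> skew\<close>]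
  note ev = matrix_nth sum_5 blk_def C
  have "C$1$5 = 0" "C$2$5 = 0" "C$3$5 = 0" "C$4$5 = 0"
    using *[of 5 1] *[of 5 2] *[of 5 3] *[of 5 4] \<open>a \<noteq> 0\<close> \<open>b \<noteq> 0\<close> by (simp_all add: ev)
  \<comment> \<open>The entries mixing the two planes satisfy two linear systems, each in two
    unknowns, with determinant \<open>a\<^sup>2 - b\<^sup>2\<close> up to sign.\<close>
  moreover have e: "- (C$1$4 * b) = a * C$2$3" "C$2$3 * b = - (a * C$1$4)"
    "C$1$3 * b = a * C$2$4" "C$2$4 * b = a * C$1$3"
    using *[of 1 3] *[of 2 4] *[of 1 4] *[of 2 3] by (simp_all add: ev)
  have "(a\<^sup>2 - b\<^sup>2) * C$1$4 = 0" "(a\<^sup>2 - b\<^sup>2) * C$2$3 = 0"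
    "(a\<^sup>2 - b\<^sup>2) * C$1$3 = 0" "(a\<^sup>2 - b\<^sup>2) * C$2$4 = 0"
    using e by algebra+
  then have "C$1$4 = 0" "C$2$3 = 0" "C$1$3 = 0" "C$2$4 = 0"
    using \<open>a\<^sup>2 \<noteq> b\<^sup>2\<close> by simp_all
  ultimately show ?thesis
    by (simp add: vec_eq_iff forall_5 blk_def C)
qed

section \<open>Rotations and the first-order condition at a maximum\<close>

definition plane_generator :: "'n \<Rightarrow> 'n \<Rightarrow> real^'n^'n"
  where "plane_generator i j =
    (\<chi> a b. (if a = i \<and> b = j then 1 else 0) - (if a = j \<and> b = i then 1 else 0))"

lemma plane_generator_skew: "plane_generator i j \<in> skew"
  by (simp add: skew_iff plane_generator_def conj_commute)

lemma mult_if_zero: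
  "x * (if P then y else 0) = (if P then x * y else 0)" "(if P then y else 0) * x = (if P then y * x else 0)"
  for x y :: "'a::mult_zero"
  by simp_all

lemma matrix_mult_plane_generator:
  "(A ** plane_generator i j) $ a $ b = (if b = j then A $ a $ i else 0) - (if b = i then A $ a $ j else 0)"
  for A :: "real^'n^'n"
  by (cases "b = i"; cases "b = j")
     (simp_all add: matrix_nth plane_generator_def right_diff_distrib sum_subtractf sum_negf mult_if_zero)

lemma inner_plane_generator:
  "plane_generator i j \<bullet> M = M $ i $ j - M $ j $ i"
proof -
  have "(\<Sum>b\<in>UNIV. plane_generator i j $ a $ b * M $ a $ b)
      = (if a = i then M $ a $ j else 0) - (if a = j then M $ a $ i else 0)" for a
    by (cases "a = i"; cases "a = j")
     (simp_all add: plane_generator_def left_diff_distrib sum_subtractf sum_negf mult_if_zero)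
  then show ?thesis
    by (simp add: inner_vec_def sum_subtractf)
qed

text \<open>The square of the generator is minus the projection onto the plane of axes
  \<open>i\<close> and \<open>j\<close>. This is the condition for Rodrigues' formula.\<close>

lemma plane_generator_cubed:
  "i \<noteq> j \<Longrightarrow> plane_generator i j ** plane_generator i j ** plane_generator i j = - plane_generator i j"
  by (auto simp add: vec_eq_iff matrix_mult_plane_generator) (auto simp: plane_generator_def)

text \<open>
  If \<open>K\<^sup>3 = -K\<close>, Rodrigues' formula \<open>exp (t K) = 1 + sin t K + (1 - cos t) K\<^sup>2\<close> gives a curve of
  orthogonal matrices, so the derivative of the maximised function along it must vanish.
\<close>

lemma orthogonal_rodrigues:
  fixes K :: "real^'n^'n"
  assumes "K \<in> skew" and K3: "K ** K ** K = - K"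
  defines "R \<equiv> \<lambda>t. mat 1 + sin t *\<^sub>R K + (1 - cos t) *\<^sub>R (K ** K)"
  shows "transpose (R t) = R (- t)" and "orthogonal_matrix (R t)"
proof -
  have tK: "transpose K = - K" using assms by (simp add: skew_def)
  show tR: "transpose (R t) = R (- t)" for t
    by (simp add: R_def transpose_add transpose_scalar matrix_transpose_mul tK matrix_minus_left
        matrix_minus_right)
  have K4: "K ** K ** (K ** K) = - (K ** K)"
    by (simp add: matrix_mul_assoc K3 matrix_minus_left)
  \<comment> \<open>The product is computed for free \<open>p\<close> and \<open>q\<close>; at
    \<open>p = sin t\<close>, \<open>q = 1 - cos t\<close> the coefficient of \<open>K ** K\<close>
    vanishes.\<close>
  have "(mat 1 - p *\<^sub>R K + q *\<^sub>R (K ** K)) ** (mat 1 + p *\<^sub>R K + q *\<^sub>R (K ** K))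
      = mat 1 + (q + q - p\<^sup>2 - q\<^sup>2) *\<^sub>R (K ** K)" for p q
    by (simp add: matrix_add_ldistrib matrix_add_rdistrib matrix_diff_left matrix_diff_right
        matrix_scaleR_left matrix_scaleR_right K4 matrix_mul_assoc[symmetric])
       (simp add: matrix_mul_assoc K3 K4 matrix_minus_left power2_eq_square
          matrix_minus_right scaleR_add_left[of q q, unfolded mult_2[symmetric]]
          scaleR_add_left scaleR_diff_left scaleR_add_right scaleR_diff_right)
  from this[of "sin t" "1 - cos t"]
  have "R (- t) ** R t = mat 1 + (2 * (1 - cos t) - (sin t)\<^sup>2 - (1 - cos t)\<^sup>2) *\<^sub>R (K ** K)"
    by (simp add: R_def)
  also have "2 * (1 - cos t) - (sin t)\<^sup>2 - (1 - cos t)\<^sup>2 = 0"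
    by (simp add: sin_squared_eq power2_eq_square algebra_simps)
  finally show "orthogonal_matrix (R t)"
    by (simp add: orthogonal_matrix tR)
qed

lemma commutator_orthogonal_if_max:
  fixes C N K :: "real^'n^'n"
  assumes max: "\<And>R. orthogonal_matrix R \<Longrightarrow> (R ** C ** transpose R) \<bullet> N \<le> C \<bullet> N"
    and K: "K \<in> skew" "K ** K ** K = - K"
  shows "(K ** C - C ** K) \<bullet> N = 0"
proof -
  define R where "R t = mat 1 + sin t *\<^sub>R K + (1 - cos t) *\<^sub>R (K ** K)" for t
  have R: "transpose (R t) = R (- t)" "orthogonal_matrix (R t)" for t
    using orthogonal_rodrigues[OF K, of t] by (simp_all add: R_def)
  define f where "f t = (R t ** C ** R (- t)) \<bullet> N" for t
  \<comment> \<open>Coefficients of \<open>f\<close> as a polynomial in \<open>sin t\<close> and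
    \<open>1 - cos t\<close>; only \<open>u\<close> belongs to a term of first order at 0.\<close>
  define u v w x y where "u = (K ** C - C ** K) \<bullet> N"
    and "v = (K ** K ** C) \<bullet> N + (C ** (K ** K)) \<bullet> N" and "w = - ((K ** C ** K) \<bullet> N)"
    and "x = (K ** C ** (K ** K)) \<bullet> N - (K ** K ** C ** K) \<bullet> N"
    and "y = (K ** K ** C ** (K ** K)) \<bullet> N"
  have "((mat 1 + p *\<^sub>R K + q *\<^sub>R (K ** K)) ** C ** (mat 1 - p *\<^sub>R K + q *\<^sub>R (K ** K))) \<bullet> N
      = C \<bullet> N + p * u + q * v + p\<^sup>2 * w + p * q * x + q\<^sup>2 * y" for p q
    unfolding u_def v_def w_def x_def y_def
    by (simp add: matrix_add_ldistrib matrix_add_rdistrib matrix_diff_left matrix_diff_right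
        matrix_scaleR_left matrix_scaleR_right inner_add_left inner_diff_left)
       (simp add: power2_eq_square algebra_simps)
  from this[of "sin _" "1 - cos _"]
  have "f t = C \<bullet> N + sin t * u + (1 - cos t) * v + (sin t)\<^sup>2 * w + sin t * (1 - cos t) * x
      + (1 - cos t)\<^sup>2 * y" for t
    by (simp add: f_def R_def)
  then have f: "f = (\<lambda>t. C \<bullet> N + sin t * u + (1 - cos t) * v + (sin t)\<^sup>2 * w
      + sin t * (1 - cos t) * x + (1 - cos t)\<^sup>2 * y)"
    by blast
  have "(f has_real_derivative u) (at 0)"
    unfolding f by (auto intro!: derivative_eq_intros)
  moreover have "f t \<le> f 0" for t
    using max[OF R(2), of t] by (simp add: f_def R(1)) (simp add: R_def)
  ultimately have "u = 0"
    using DERIV_local_max[of f u 0 1] by simp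
  then show ?thesis by (simp add: u_def)
qed

text \<open>By cyclicity of the trace, the first-order condition along a generator \<open>K\<close>
  says that \<open>K\<close> is orthogonal to the commutator of \<open>C\<close> and
  \<open>N\<close>. The plane generators detect every off-diagonal entry of this skew
  matrix.\<close>

lemma commute_if_max:
  fixes C N :: "real^'n^'n"
  assumes max: "\<And>R. orthogonal_matrix R \<Longrightarrow> (R ** C ** transpose R) \<bullet> N \<le> C \<bullet> N"
    and C: "C \<in> skew" and N: "N \<in> skew"
  shows "C ** N = N ** C"
proof -
  have "(C ** N) $ i $ j = (N ** C) $ i $ j" for i j
  proof (cases "i = j")
    case True
    \<comment> \<open>The two products are transposes of each other and so share their
      diagonal.\<close>
    have "transpose (C ** N) = N ** C"
      using C N by (simp add: skew_def matrix_transpose_mul matrix_minus_left matrix_minus_right)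
    then have "(N ** C) $ i $ i = transpose (C ** N) $ i $ i"
      by simp
    then show ?thesis using True by (simp add: transpose_def)
  next
    case False
    let ?K = "plane_generator i j :: real^'n^'n"
    let ?M = "C ** N - N ** C"
    have "transpose ?M = - ?M"
      using C N by (simp add: skew_def transpose_matrix_diff matrix_transpose_mul matrix_minus_left matrix_minus_right)
    then have M: "?M $ j $ i = - ?M $ i $ j"
      by (intro skew_nth) (simp add: skew_def)
    have "0 = (?K ** C - C ** ?K) \<bullet> N"
      using commutator_orthogonal_if_max[OF max plane_generator_skew plane_generator_cubed[OF False]]
      by simp
    also have "\<dots> = - trace (N ** (?K ** C) - N ** (C ** ?K))"
      using inner_skew_left[OF N, of "?K ** C - C ** ?K"]
      by (simp add: inner_commute matrix_diff_right)
    also have "\<dots> = - trace (?K ** ?M)"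
      using trace_mul_sym[of "N" "?K ** C"] trace_mul_sym[of "N ** C" ?K]
      by (simp add: trace_sub matrix_diff_right matrix_mul_assoc)
    also have "\<dots> = ?K \<bullet> ?M"
      by (simp add: inner_skew_left plane_generator_skew)
    also have "\<dots> = 2 * ?M $ i $ j"
      unfolding inner_plane_generator M by simp
    finally show ?thesis by simp
  qed
  then show ?thesis by (simp add: vec_eq_iff)
qed

text \<open>A closed set, on which the norm has the constant value \<open>sqrt CARD('n)\<close>.
  Compactness supplies the maximiser for the normal form.\<close>

lemma compact_orthogonal_matrices: "compact {Q :: real^'n^'n. orthogonal_matrix Q}"
proof -
  have "closed {Q :: real^'n^'n. transpose Q ** Q = mat 1}"
  proof (rule closed_Collect_eq)
    have "bounded_linear (transpose :: real^'n^'n \<Rightarrow> real^'n^'n)"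
      unfolding linear_conv_bounded_linear[symmetric]
      by (auto intro!: linearI simp: transpose_add transpose_scalar)
    then show "continuous_on UNIV (\<lambda>Q :: real^'n^'n. transpose Q ** Q)"
      by (intro bounded_bilinear.continuous_on[OF bounded_bilinear_matrix_mult]
          linear_continuous_on continuous_on_id)
  qed simp
  moreover have "bounded {Q :: real^'n^'n. transpose Q ** Q = mat 1}"
    unfolding bounded_iff
    by (rule exI[of _ "sqrt CARD('n)"]) (simp add: norm_eq_sqrt_inner inner_matrix_eq_trace trace_I)
  ultimately show ?thesis
    by (simp add: orthogonal_matrix compact_eq_bounded_closed)
qed

text \<open>Reflecting axis 1 or axis 3 reverses one block, and exchanging the two planes swaps the
  blocks. These are the competitors that order the blocks of a maximiser.\<close>

lemma blk_conj_signs: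
  "\<exists>R. orthogonal_matrix R \<and> R ** blk a b ** transpose R = blk (- a) b"
  "\<exists>R. orthogonal_matrix R \<and> R ** blk a b ** transpose R = blk a (- b)"
  "\<exists>R. orthogonal_matrix R \<and> R ** blk a b ** transpose R = blk b a"
proof -
  let ?D = "\<lambda>k::5. (\<chi> i j. if i = j then if i = k then -1 else 1 else 0) :: real^5^5"
  have "orthogonal_matrix (?D 1)" "orthogonal_matrix (?D 3)"
    by (simp_all add: orthogonal_matrix transpose_def vec_eq_iff matrix_nth sum_5 forall_5 mat_def)
  moreover have "?D 1 ** blk a b ** transpose (?D 1) = blk (- a) b"
    "?D 3 ** blk a b ** transpose (?D 3) = blk a (- b)"
    by (simp_all add: transpose_def vec_eq_iff matrix_nth sum_5 forall_5 blk_def)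
  ultimately show "\<exists>R. orthogonal_matrix R \<and> R ** blk a b ** transpose R = blk (- a) b"
  "\<exists>R. orthogonal_matrix R \<and> R ** blk a b ** transpose R = blk a (- b)"
    by blast+
  let ?S = "(\<chi> i j. if (i, j) \<in> {(1, 3), (2, 4), (3, 1), (4, 2), (5, 5)} then 1 else 0) :: real^5^5"
  have "orthogonal_matrix ?S"
    by (simp add: orthogonal_matrix transpose_def vec_eq_iff matrix_nth sum_5 forall_5 mat_def)
  moreover have "?S ** blk a b ** transpose ?S = blk b a"
    by (simp add: transpose_def vec_eq_iff matrix_nth sum_5 forall_5 blk_def)
  ultimately show "\<exists>R. orthogonal_matrix R \<and> R ** blk a b ** transpose R = blk b a"
    by blast
qed

lemma skew_normal_form:
  assumes "B \<in> skew"
  shows "\<exists>Q a b. orthogonal_matrix Q \<and> 0 \<le> b \<and> b \<le> a \<and> B = Q ** blk a b ** transpose Q"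
proof -
  \<comment> \<open>The test matrix \<open>blk 2 1\<close> is generic: 2 and 1 are nonzero with
    different squares, as \<open>commute_blk\<close> requires.\<close>
  define f where "f Q = (Q ** B ** transpose Q) \<bullet> blk 2 1" for Q
  have "bounded_linear (transpose :: real^5^5 \<Rightarrow> real^5^5)"
      unfolding linear_conv_bounded_linear[symmetric]
      by (auto intro!: linearI simp: transpose_add transpose_scalar)
  then have "continuous_on {Q. orthogonal_matrix Q} f"
    unfolding f_def
    by (intro continuous_intros bounded_bilinear.continuous_on[OF bounded_bilinear_matrix_mult]
          linear_continuous_on)
  moreover have "{Q :: real^5^5. orthogonal_matrix Q} \<noteq> {}"
    using orthogonal_matrix_id by blast
  ultimately obtain Q where Q: "orthogonal_matrix Q"
    and Qmax: "\<And>R. orthogonal_matrix R \<Longrightarrow> f R \<le> f Q"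
    using continuous_attains_sup[OF compact_orthogonal_matrices] by blast
  define C where "C = Q ** B ** transpose Q"
  have C: "C \<in> skew" unfolding C_def by (rule skew_orthogonal_conj[OF assms])
  have max: "(R ** C ** transpose R) \<bullet> blk 2 1 \<le> C \<bullet> blk 2 1" if "orthogonal_matrix R" for R
    using Qmax[OF orthogonal_matrix_mul[OF that Q]]
    by (simp add: f_def C_def matrix_transpose_mul matrix_mul_assoc)
  have "C ** blk 2 1 = blk 2 1 ** C"
    by (rule commute_if_max[OF max C blk_skew])
  then obtain a b where ab: "C = blk a b"
    using commute_blk[OF C] by fastforce
  \<comment> \<open>The maximal value is \<open>4 * a + 2 * b\<close>. Comparing it with the sign
    flips and the swap gives \<open>0 \<le> a\<close>, \<open>0 \<le> b\<close> and
    \<open>b \<le> a\<close>.\<close>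
  have "4 * a' + 2 * b' \<le> 4 * a + 2 * b"
    if "\<exists>R. orthogonal_matrix R \<and> R ** blk a b ** transpose R = blk a' b'" for a' b'
    using that max unfolding ab by (force simp: inner_blk)
  from this[OF blk_conj_signs(1)] this[OF blk_conj_signs(2)] this[OF blk_conj_signs(3)]
  have "0 \<le> b" "b \<le> a" by simp_all
  moreover have "B = transpose Q ** blk a b ** transpose (transpose Q)"
    using orthogonal_conj_inverse[OF Q, of B] by (simp add: ab[symmetric] C_def)
  moreover have "orthogonal_matrix (transpose Q)"
    using Q by simp
  ultimately show ?thesis by blast
qed

subsection \<open>The map \<open>\<Lambda> \<mapsto> B\<close>\<close>

definition quartic_gradient :: "real^'n^'n \<Rightarrow> real^'n^'n"
  where "quartic_gradient L = - 24 *\<^sub>R (4 *\<^sub>R (L ** L ** L) + (L \<bullet> L) *\<^sub>R L)"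

lemma quartic_gradient_skew:
  assumes "L \<in> skew"
  shows "quartic_gradient L \<in> skew"
  using assms
  by (simp add: skew_def quartic_gradient_def transpose_add transpose_matrix_diff transpose_uminus transpose_scalar
      matrix_transpose_mul matrix_minus_left matrix_minus_right matrix_mul_assoc algebra_simps)

text \<open>The product rule gives four terms for the quartic trace and two for the quadratic one;
  cyclicity merges them, and skewness of \<open>L\<close> turns traces into inner products.\<close>

lemma inv_I_has_derivative:
  assumes L: "L \<in> skew"
  shows "(inv_I has_derivative (\<lambda>X. quartic_gradient L \<bullet> X)) (at L within S)"
proof -
  note mult = bounded_bilinear.FDERIV[OF bounded_bilinear_matrix_mult]
  note tr = bounded_linear.has_derivative[OF bounded_linear_trace]
  have cyc: "trace (L ** L ** X ** L) = trace (L ** L ** L ** X)"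
    "trace (L ** X ** L ** L) = trace (L ** L ** L ** X)"
    "trace (X ** L ** L ** L) = trace (L ** L ** L ** X)"
    "trace (X ** L) = trace (L ** X)" for X
    using trace_mul_sym[of "L ** L ** X" L] trace_mul_sym[of "L ** X" "L ** L"]
      trace_mul_sym[of X "L ** L ** L"] trace_mul_sym[of X L]
    by (simp_all add: matrix_mul_assoc)
  have tL: "transpose L = - L" using L by (simp add: skew_def)
  have G: "quartic_gradient L \<bullet> X
      = 6 * (4 * (4 * trace (L ** L ** L ** X)) - 2 * trace (L ** L) * (2 * trace (L ** X)))" for X
    unfolding quartic_gradient_def
    by (simp add: inner_matrix_eq_trace transpose_add transpose_matrix_diff transpose_uminus transpose_scalar
        matrix_transpose_mul tL matrix_minus_left matrix_minus_right matrix_mul_assoc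
        matrix_add_rdistrib matrix_diff_left matrix_scaleR_left trace_add trace_sub trace_scaleR trace_uminus algebra_simps)
  have "(inv_I has_derivative (\<lambda>X. 6 * (4 * trace (L ** L ** L ** X + (L ** L ** X + (L ** X + X ** L) ** L) ** L)
      - 2 * trace (L ** L) * trace (L ** X + X ** L)))) (at L within S)"
    unfolding inv_I_def power2_eq_square
    by (rule derivative_eq_intros mult tr refl)+ (simp add: fun_eq_iff)
  also have "(\<lambda>X. 6 * (4 * trace (L ** L ** L ** X + (L ** L ** X + (L ** X + X ** L) ** L) ** L)
      - 2 * trace (L ** L) * trace (L ** X + X ** L))) = (\<lambda>X. quartic_gradient L \<bullet> X)"
  proof
    fix X
    show "6 * (4 * trace (L ** L ** L ** X + (L ** L ** X + (L ** X + X ** L) ** L) ** L)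
      - 2 * trace (L ** L) * trace (L ** X + X ** L)) = quartic_gradient L \<bullet> X"
      unfolding G trace_add matrix_add_rdistrib cyc[of X] by simp
  qed
  finally show ?thesis .
qed

text \<open>For uniqueness, the difference \<open>D\<close> of two gradients is itself a skew
  direction, along which the derivative of the zero function is
  \<open>D \<bullet> D\<close>.\<close>

lemma skew_gradient_inv_I:
  assumes L: "L \<in> skew"
  shows "skew_gradient inv_I L = quartic_gradient L"
  unfolding skew_gradient_def
proof (rule the_equality)
  show "quartic_gradient L \<in> skew \<and>
      (inv_I has_derivative (\<lambda>X. quartic_gradient L \<bullet> X)) (at L within skew)"
    using quartic_gradient_skew[OF L] inv_I_has_derivative[OF L] by blast
next
  fix G :: "real^5^5"
  assume G: "G \<in> skew \<and> (inv_I has_derivative (\<lambda>X. G \<bullet> X)) (at L within skew)"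
  define D where "D = G - quartic_gradient L"
  have D: "D \<in> skew"
    using G quartic_gradient_skew[OF L] by (simp add: D_def skew_def transpose_matrix_diff)
  have line: "L + t *\<^sub>R D \<in> skew" for t
    using L D by (simp add: skew_def transpose_add transpose_scalar)
  have "((\<lambda>X. inv_I X - inv_I X) has_derivative (\<lambda>X. G \<bullet> X - quartic_gradient L \<bullet> X)) (at L within skew)"
    by (intro has_derivative_diff inv_I_has_derivative L conjunct2[OF G])
  then have "((\<lambda>X. 0) has_derivative (\<lambda>X. D \<bullet> X)) (at (L + 0 *\<^sub>R D) within skew)"
    by (simp add: D_def inner_diff_left)
  \<comment> \<open>Restriction to the line through \<open>L\<close> in direction \<open>D\<close>
    leaves a function of one real variable, whose derivative is unique.\<close>
  then have "((\<lambda>X. 0) has_derivative (\<lambda>X. D \<bullet> X)) (at (L + 0 *\<^sub>R D) within range (\<lambda>t. L + t *\<^sub>R D))"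
    by (rule has_derivative_subset) (use line in blast)
  moreover have "((\<lambda>t. L + t *\<^sub>R D) has_derivative (\<lambda>t. t *\<^sub>R D)) (at 0)"
    by (auto intro!: derivative_eq_intros)
  ultimately have "((\<lambda>t. 0) has_derivative (\<lambda>t. D \<bullet> (t *\<^sub>R D))) (at (0::real))"
    using has_derivative_in_compose[of "\<lambda>t. L + t *\<^sub>R D" "\<lambda>t. t *\<^sub>R D" 0 UNIV "\<lambda>X. 0::real" "\<lambda>X. D \<bullet> X"]
    by simp
  then have "(\<lambda>t. D \<bullet> (t *\<^sub>R D)) = (\<lambda>t. 0)"
    by (rule has_derivative_unique) simp
  then have "D \<bullet> (1 *\<^sub>R D) = 0"
    by (rule fun_cong)
  then show "G = quartic_gradient L"
    by (simp add: D_def)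
qed

lemma B_map_skew_eq:
  "L \<in> skew \<Longrightarrow> B_map V L = - L + deriv V (inv_I L) *\<^sub>R quartic_gradient L"
  by (simp add: B_map_def skew_gradient_inv_I)

lemma quartic_gradient_orthogonal_conj:
  assumes "orthogonal_matrix Q"
  shows "quartic_gradient (Q ** L ** transpose Q) = Q ** quartic_gradient L ** transpose Q"
  unfolding quartic_gradient_def
  by (simp only: orthogonal_conj_mult inner_orthogonal_conj assms)
     (simp add: matrix_add_ldistrib matrix_add_rdistrib matrix_scaleR_left matrix_scaleR_right
       matrix_minus_left matrix_minus_right)

lemma B_map_orthogonal_conj:
  assumes "orthogonal_matrix Q" "L \<in> skew"
  shows "B_map V (Q ** L ** transpose Q) = Q ** B_map V L ** transpose Q"
  using assms
  by (simp add: B_map_skew_eq skew_orthogonal_conj inv_I_orthogonal_conj quartic_gradient_orthogonal_conj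
      matrix_add_ldistrib matrix_add_rdistrib matrix_scaleR_left matrix_scaleR_right
      matrix_minus_left matrix_minus_right matrix_diff_left matrix_diff_right)

text \<open>\<open>B_map V L\<close> is a linear combination of \<open>L\<close> and its
  cube.\<close>

lemma B_map_commute:
  assumes "L \<in> skew"
  shows "L ** B_map V L = B_map V L ** L"
  using assms
  by (simp add: B_map_skew_eq quartic_gradient_def matrix_add_ldistrib matrix_add_rdistrib
      matrix_scaleR_left matrix_scaleR_right matrix_minus_left matrix_minus_right matrix_diff_left
      matrix_diff_right matrix_mul_assoc)

text \<open>The cube of \<open>blk a b\<close> is \<open>blk (- (a ^ 3)) (- (b ^ 3))\<close>, so the
  matrix equation for \<open>B\<close> reduces to two scalar ones, coupled through
  \<open>c\<close>.\<close>

lemma B_map_blk: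
  defines "c \<equiv> \<lambda>V a b. 48 * deriv V (inv_I (blk a b)) * (a\<^sup>2 - b\<^sup>2)"
  shows "B_map V (blk a b) = blk (- a * (1 - c V a b)) (- b * (1 + c V a b))"
proof -
  have sq: "blk a b ** blk a b = (\<chi> i j. if i = j then if i = 1 \<or> i = 2 then - (a * a)
      else if i = 3 \<or> i = 4 then - (b * b) else 0 else 0)"
    by (simp add: vec_eq_iff forall_5 matrix_nth sum_5 blk_def)
  have "blk a b ** blk a b ** blk a b = blk (- (a ^ 3)) (- (b ^ 3))"
    unfolding sq by (simp add: vec_eq_iff forall_5 matrix_nth sum_5 blk_def power3_eq_cube)
  then have "quartic_gradient (blk a b) = blk (48 * a * (a\<^sup>2 - b\<^sup>2)) (- 48 * b * (a\<^sup>2 - b\<^sup>2))"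
    unfolding quartic_gradient_def inner_blk
    by (simp add: vec_eq_iff forall_5) (simp add: blk_def power3_eq_cube power2_eq_square algebra_simps)
  then show ?thesis
    by (simp add: B_map_skew_eq blk_skew c_def) (simp add: vec_eq_iff forall_5 blk_def algebra_simps)
qed

subsection \<open>The Hamiltonian\<close>

text \<open>\<open>major\<close> and \<open>minor\<close> invert
  \<open>s = (a\<^sup>2 + b\<^sup>2) / 2\<close>, \<open>p = a * b\<close> for
  \<open>0 \<le> b \<le> a\<close>: there \<open>2 * (s + p)\<close> and \<open>2 * (s - p)\<close>
  are the squares of \<open>a + b\<close> and \<open>a - b\<close>.\<close>

definition major :: "real \<Rightarrow> real \<Rightarrow> real"
  where "major s p = (sqrt (2 * (s + p)) + sqrt (2 * (s - p))) / 2"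

definition minor :: "real \<Rightarrow> real \<Rightarrow> real"
  where "minor s p = (sqrt (2 * (s + p)) - sqrt (2 * (s - p))) / 2"

lemma major_minor_invariants:
  assumes "b \<le> a" "0 \<le> b"
  shows "major ((a\<^sup>2 + b\<^sup>2) / 2) (a * b) = a" "minor ((a\<^sup>2 + b\<^sup>2) / 2) (a * b) = b"
proof -
  have "2 * ((a\<^sup>2 + b\<^sup>2) / 2 + a * b) = (a + b)\<^sup>2" "2 * ((a\<^sup>2 + b\<^sup>2) / 2 - a * b) = (a - b)\<^sup>2"
    by (simp_all add: power2_eq_square field_simps)
  then have "sqrt (2 * ((a\<^sup>2 + b\<^sup>2) / 2 + a * b)) = a + b" "sqrt (2 * ((a\<^sup>2 + b\<^sup>2) / 2 - a * b)) = a - b"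
    using assms by (simp_all only: real_sqrt_abs)
  then show "major ((a\<^sup>2 + b\<^sup>2) / 2) (a * b) = a" "minor ((a\<^sup>2 + b\<^sup>2) / 2) (a * b) = b"
    unfolding major_def minor_def by simp_all
qed

lemma major_minor_eqs:
  assumes "p < s" "0 < p"
  shows "((major s p)\<^sup>2 + (minor s p)\<^sup>2) / 2 = s" "major s p * minor s p = p"
    "0 < minor s p" "minor s p < major s p"
proof -
  define u v where "u = sqrt (2 * (s + p))" and "v = sqrt (2 * (s - p))"
  have uv: "u\<^sup>2 = 2 * (s + p)" "v\<^sup>2 = 2 * (s - p)" "0 < v" "v < u"
    using assms by (simp_all add: u_def v_def)
  show "((major s p)\<^sup>2 + (minor s p)\<^sup>2) / 2 = s" "major s p * minor s p = p"
    unfolding major_def minor_def u_def[symmetric] v_def[symmetric]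
    using uv(1,2) by (simp_all add: power2_eq_square field_simps)
  show "0 < minor s p" "minor s p < major s p"
    unfolding major_def minor_def u_def[symmetric] v_def[symmetric] using uv by simp_all
qed

text \<open>The inverse of the linear system \<open>ds = a da + b db\<close>,
  \<open>dp = b da + a db\<close>, whose determinant \<open>d\<close> is nonzero for
  \<open>p < s\<close>.\<close>

lemma major_minor_has_derivative:
  assumes "p < s" "0 < p"
  defines "d \<equiv> (major s p)\<^sup>2 - (minor s p)\<^sup>2"
  shows "((\<lambda>z. major (fst z) (snd z)) has_derivative
      (\<lambda>h. (major s p * fst h - minor s p * snd h) / d)) (at (s, p))"
    and "((\<lambda>z. minor (fst z) (snd z)) has_derivative
      (\<lambda>h. (major s p * snd h - minor s p * fst h) / d)) (at (s, p))"
proof -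
  define u v where "u = sqrt (2 * (s + p))" and "v = sqrt (2 * (s - p))"
  have uv: "0 < v" "0 < u" using assms by (simp_all add: u_def v_def)
  have d: "d = u * v"
    unfolding d_def major_def minor_def u_def[symmetric] v_def[symmetric]
    by (simp add: power2_eq_square field_simps)
  have u: "((\<lambda>z. sqrt (2 * (fst z + snd z))) has_derivative (\<lambda>h. (fst h + snd h) / u)) (at (s, p))"
    using uv unfolding u_def
    by (auto intro!: derivative_eq_intros simp: field_simps)
  have v: "((\<lambda>z. sqrt (2 * (fst z - snd z))) has_derivative (\<lambda>h. (fst h - snd h) / v)) (at (s, p))"
    using uv unfolding v_def
    by (auto intro!: derivative_eq_intros simp: field_simps)
  show "((\<lambda>z. major (fst z) (snd z)) has_derivative
      (\<lambda>h. (major s p * fst h - minor s p * snd h) / d)) (at (s, p))"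
    unfolding major_def minor_def d u_def[symmetric] v_def[symmetric]
    by (rule has_derivative_eq_rhs[OF bounded_linear.has_derivative[OF bounded_linear_divide has_derivative_add[OF u v]]])
       (use uv in \<open>simp_all add: fun_eq_iff field_simps\<close>)
  show "((\<lambda>z. minor (fst z) (snd z)) has_derivative
      (\<lambda>h. (major s p * snd h - minor s p * fst h) / d)) (at (s, p))"
    unfolding major_def minor_def d u_def[symmetric] v_def[symmetric]
    by (rule has_derivative_eq_rhs[OF bounded_linear.has_derivative[OF bounded_linear_divide has_derivative_diff[OF u v]]])
       (use uv in \<open>simp_all add: fun_eq_iff field_simps\<close>)
qed

text \<open>The invariants of \<open>B\<close> are those of its normal form and determine both
  blocks, so \<open>s\<close> and \<open>p\<close> separate the orbits.\<close>

lemma skew_normal_form_invariants: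
  assumes "B \<in> skew"
  shows "\<exists>Q. orthogonal_matrix Q \<and>
    B = Q ** blk (major (inv_s B) (inv_p B)) (minor (inv_s B) (inv_p B)) ** transpose Q"
proof -
  obtain Q a b where Q: "orthogonal_matrix Q" and ab: "0 \<le> b" "b \<le> a"
    and B: "B = Q ** blk a b ** transpose Q"
    using skew_normal_form[OF assms] by blast
  have "inv_s B = (a\<^sup>2 + b\<^sup>2) / 2" "inv_p B = a * b"
    using ab by (simp_all add: B inv_s_orthogonal_conj[OF Q] inv_p_orthogonal_conj[OF Q] blk_skew
        inv_s_blk inv_p_blk)
  then have "major (inv_s B) (inv_p B) = a" "minor (inv_s B) (inv_p B) = b"
    by (simp_all only: major_minor_invariants[OF ab(2,1)])
  then show ?thesis
    using Q B by (intro exI[of _ Q]) (simp only:)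
qed

text \<open>
  Here \<open>(a, b)\<close> and \<open>(\<alpha>, \<beta>)\<close> are the skew eigenvalues of \<open>\<Lambda>\<close> and \<open>B\<close>, \<open>c = 48 V'(I) (a\<^sup>2 - b\<^sup>2)\<close>,
  and \<open>Hs\<close>, \<open>Hp\<close> are solved from \<open>\<alpha> Hs + \<beta> Hp = - (2 a + \<alpha>)\<close>, \<open>\<beta> Hs + \<alpha> Hp = - (2 b + \<beta>)\<close>.
\<close>

lemma legendre_algebra:
  fixes a b V V1 :: real
  defines "c \<equiv> 48 * V1 * (a\<^sup>2 - b\<^sup>2)" and "I \<equiv> 24 * (a\<^sup>2 - b\<^sup>2)\<^sup>2"
  defines "\<alpha> \<equiv> - a * (1 - c)" and "\<beta> \<equiv> - b * (1 + c)"
  defines "s \<equiv> (\<alpha>\<^sup>2 + \<beta>\<^sup>2) / 2" and "p \<equiv> \<alpha> * \<beta>" and "d \<equiv> \<alpha>\<^sup>2 - \<beta>\<^sup>2"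
  defines "h \<equiv> s - ((a + \<alpha>)\<^sup>2 + (b + \<beta>)\<^sup>2) + V"
  assumes d: "d \<noteq> 0" and p: "p \<noteq> 0"
    and Hs: "Hs = ((2 * b + \<beta>) * \<beta> - (2 * a + \<alpha>) * \<alpha>) / d"
    and Hp: "Hp = ((2 * a + \<alpha>) * \<beta> - (2 * b + \<beta>) * \<alpha>) / d"
  shows "2 * I * V1 - V = s * Hs + p * Hp - h"
    and "(s\<^sup>2 - p\<^sup>2) / p * Hs * Hp = - 2 * I * V1"
    and "I = 6 * (s\<^sup>2 - p\<^sup>2) * (Hp\<^sup>2 - (1 + Hs)\<^sup>2)\<^sup>2"
proof -
  have sp: "s\<^sup>2 - p\<^sup>2 = d\<^sup>2 / 4"
    by (simp add: s_def p_def d_def power2_eq_square field_simps)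
  have IV: "2 * I * V1 = c * (a\<^sup>2 - b\<^sup>2)"
    by (simp add: I_def c_def power2_eq_square)
  have Hsd: "Hs * d = (a\<^sup>2 - b\<^sup>2) * (1 - c\<^sup>2)"
  proof -
    have "Hs * d = (2 * b + \<beta>) * \<beta> - (2 * a + \<alpha>) * \<alpha>" using d by (simp add: Hs)
    then show ?thesis by (simp add: \<alpha>_def \<beta>_def power2_eq_square algebra_simps)
  qed
  have Hpd: "Hp * d = - 4 * a * b * c"
  proof -
    have "Hp * d = (2 * a + \<alpha>) * \<beta> - (2 * b + \<beta>) * \<alpha>" using d by (simp add: Hp)
    then show ?thesis by (simp add: \<alpha>_def \<beta>_def power2_eq_square algebra_simps)
  qed
  have e: "\<alpha> * Hs + \<beta> * Hp = - (2 * a + \<alpha>)" "\<beta> * Hs + \<alpha> * Hp = - (2 * b + \<beta>)"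
    using d unfolding Hs Hp by (simp_all add: field_simps) (simp_all add: d_def power2_eq_square algebra_simps)
  \<comment> \<open>Since \<open>s\<close> and \<open>p\<close> are quadratic in
    \<open>\<alpha>\<close> and \<open>\<beta>\<close>, this is half the Euler operator in these
    variables.\<close>
  have "s * Hs + p * Hp = (\<alpha> * (\<alpha> * Hs + \<beta> * Hp) + \<beta> * (\<beta> * Hs + \<alpha> * Hp)) / 2"
    by (simp add: s_def p_def power2_eq_square field_simps)
  also have "\<dots> = - (\<alpha> * (2 * a + \<alpha>) + \<beta> * (2 * b + \<beta>)) / 2"
    unfolding e by (simp add: field_simps)
  finally have sHs: "s * Hs + p * Hp = - (\<alpha> * (2 * a + \<alpha>) + \<beta> * (2 * b + \<beta>)) / 2" .
  show "2 * I * V1 - V = s * Hs + p * Hp - h"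
    unfolding IV sHs unfolding h_def s_def by (simp add: \<alpha>_def \<beta>_def power2_eq_square field_simps)
  have "(s\<^sup>2 - p\<^sup>2) / p * Hs * Hp = (Hs * d) * (Hp * d) / (4 * p)"
    unfolding sp by (simp add: power2_eq_square)
  also have "\<dots> = - c * (a\<^sup>2 - b\<^sup>2)"
    unfolding Hsd Hpd using p by (simp add: p_def \<alpha>_def \<beta>_def power2_eq_square field_simps)
  finally show "(s\<^sup>2 - p\<^sup>2) / p * Hs * Hp = - 2 * I * V1"
    using IV by simp
  \<comment> \<open>The symmetric map with rows \<open>(\<alpha>, \<beta>)\<close> and
    \<open>(\<beta>, \<alpha>)\<close> scales the form \<open>x\<^sup>2 - y\<^sup>2\<close> by
    \<open>d\<close>. It sends \<open>(1 + Hs, Hp)\<close> to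
    \<open>(- 2 * a, - 2 * b)\<close>.\<close>
  have "(\<alpha> * (1 + Hs) + \<beta> * Hp)\<^sup>2 - (\<beta> * (1 + Hs) + \<alpha> * Hp)\<^sup>2 = d * ((1 + Hs)\<^sup>2 - Hp\<^sup>2)"
    by (simp add: d_def power2_eq_square algebra_simps)
  moreover have "\<alpha> * (1 + Hs) + \<beta> * Hp = - 2 * a" "\<beta> * (1 + Hs) + \<alpha> * Hp = - 2 * b"
    using e by (simp_all add: algebra_simps)
  ultimately have "4 * (a\<^sup>2 - b\<^sup>2) = d * ((1 + Hs)\<^sup>2 - Hp\<^sup>2)"
    by (simp add: power_mult_distrib)
  then have "16 * (a\<^sup>2 - b\<^sup>2)\<^sup>2 = d\<^sup>2 * ((1 + Hs)\<^sup>2 - Hp\<^sup>2)\<^sup>2"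
    by algebra
  then show "I = 6 * (s\<^sup>2 - p\<^sup>2) * (Hp\<^sup>2 - (1 + Hs)\<^sup>2)\<^sup>2"
    unfolding sp I_def by (simp add: power2_commute[of "Hp\<^sup>2"])
qed

lemma partial_derivatives:
  fixes H :: "real \<Rightarrow> real \<Rightarrow> real"
  assumes "((\<lambda>(x, y). H x y) has_derivative D) (at (s, p))"
  shows "deriv (\<lambda>x. H x p) s = D (1, 0)" "deriv (\<lambda>y. H s y) p = D (0, 1)"
proof -
  have lin: "D (x *\<^sub>R z) = x *\<^sub>R D z" for x z
    using has_derivative_linear[OF assms] by (rule linear_scale)
  have "((\<lambda>x. (\<lambda>(x, y). H x y) (x, p)) has_derivative (\<lambda>h. D (h, 0))) (at s)"
    by (rule has_derivative_compose[of "\<lambda>x. (x, p)" "\<lambda>h. (h, 0)" s UNIV, OF _ assms]) (auto intro!: derivative_eq_intros)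
  moreover have "(\<lambda>h. D (h, 0)) = (*) (D (1, 0))"
  proof
    show "D (h, 0) = D (1, 0) * h" for h
      using lin[of h "(1, 0)"] by (simp add: mult.commute)
  qed
  ultimately have "((\<lambda>x. H x p) has_real_derivative D (1, 0)) (at s)"
    by (simp add: has_field_derivative_def)
  then show "deriv (\<lambda>x. H x p) s = D (1, 0)"
    by (rule DERIV_imp_deriv)
  have "((\<lambda>y. (\<lambda>(x, y). H x y) (s, y)) has_derivative (\<lambda>h. D (0, h))) (at p)"
    by (rule has_derivative_compose[of "\<lambda>y. (s, y)" "\<lambda>h. (0, h)" p UNIV, OF _ assms]) (auto intro!: derivative_eq_intros)
  moreover have "(\<lambda>h. D (0, h)) = (*) (D (0, 1))"
  proof
    show "D (0, h) = D (0, 1) * h" for h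
      using lin[of h "(0, 1)"] by (simp add: mult.commute)
  qed
  ultimately have "((\<lambda>y. H s y) has_real_derivative D (0, 1)) (at p)"
    by (simp add: has_field_derivative_def)
  then show "deriv (\<lambda>y. H s y) p = D (0, 1)"
    by (rule DERIV_imp_deriv)
qed

section \<open>Equivariance of the inverse map and differentiation of the Hamiltonian\<close>

locale duality_map =
  fixes U T :: "(real^5^5) set" and W :: "real set" and V :: "real \<Rightarrow> real"
  assumes U_open: "openin (top_of_set skew) U"
    and U_invariant: "orthogonally_invariant U"
    and W_open: "open W" and inv_I_U: "inv_I ` U \<subseteq> W"
    and V_smooth: "smooth_on UNIV W V"
    and diffeo: "diffeomorphism_on skew U T (B_map V)"
begin

lemma U_skew: "A \<in> U \<Longrightarrow> A \<in> skew"
  using openin_subset[OF U_open] by auto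

lemma T_open: "openin (top_of_set skew) T"
  using diffeo by (simp add: diffeomorphism_on_def)

lemma T_skew: "B \<in> T \<Longrightarrow> B \<in> skew"
  using openin_subset[OF T_open] by auto

lemma B_map_bij: "bij_betw (B_map V) U T"
  using diffeo by (simp add: diffeomorphism_on_def)

lemma Lambda_of_in: "B \<in> T \<Longrightarrow> Lambda_of V U B \<in> U"
  using B_map_bij unfolding Lambda_of_def bij_betw_def by (blast intro: inv_into_into)

lemma B_map_Lambda_of: "B \<in> T \<Longrightarrow> B_map V (Lambda_of V U B) = B"
  using B_map_bij unfolding Lambda_of_def bij_betw_def by (blast intro: f_inv_into_f)

lemma Lambda_of_eqI: "L \<in> U \<Longrightarrow> B_map V L = B \<Longrightarrow> Lambda_of V U B = L"
  using B_map_bij unfolding Lambda_of_def bij_betw_def by (blast intro: inv_into_f_eq)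

text \<open>\<open>B_map\<close> commutes with conjugation and \<open>U\<close> is invariant;
  injectivity on \<open>U\<close> then identifies the preimage of the conjugated matrix.\<close>

lemma orthogonal_conj_T:
  assumes "orthogonal_matrix Q" "B \<in> T"
  shows "Q ** B ** transpose Q \<in> T"
    and "Lambda_of V U (Q ** B ** transpose Q) = Q ** Lambda_of V U B ** transpose Q"
proof -
  let ?L = "Lambda_of V U B"
  have L: "?L \<in> U" by (rule Lambda_of_in[OF assms(2)])
  have QL: "Q ** ?L ** transpose Q \<in> U"
    using U_invariant L assms(1) by (simp add: orthogonally_invariant_def)
  have eq: "B_map V (Q ** ?L ** transpose Q) = Q ** B ** transpose Q"
    by (simp add: B_map_orthogonal_conj assms U_skew[OF L] B_map_Lambda_of)
  show "Q ** B ** transpose Q \<in> T"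
    using B_map_bij QL eq unfolding bij_betw_def by (metis imageI)
  show "Lambda_of V U (Q ** B ** transpose Q) = Q ** Lambda_of V U B ** transpose Q"
    by (rule Lambda_of_eqI[OF QL eq])
qed

lemma hamiltonian_orthogonal_conj:
  assumes "orthogonal_matrix Q" "B \<in> T"
  shows "hamiltonian V U (Q ** B ** transpose Q) = hamiltonian V U B"
proof -
  have "Q ** A ** transpose Q + Q ** B ** transpose Q = Q ** (A + B) ** transpose Q" for A B
    by (simp add: matrix_add_ldistrib matrix_add_rdistrib)
  then show ?thesis
    by (simp add: hamiltonian_def orthogonal_conj_T assms inner_orthogonal_conj inv_I_orthogonal_conj Let_def)
qed

text \<open>Conjugation stays in \<open>T\<close> and preserves all quantities in the identities, so
  these may be checked at the block diagonal representative.\<close>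

lemma normal_form_in_T:
  assumes "B \<in> T"
  defines "N \<equiv> blk (major (inv_s B) (inv_p B)) (minor (inv_s B) (inv_p B))"
  shows "N \<in> T" "hamiltonian V U N = hamiltonian V U B"
    "inv_I (Lambda_of V U N) = inv_I (Lambda_of V U B)"
proof -
  obtain Q where Q: "orthogonal_matrix Q" and B: "B = Q ** N ** transpose Q"
    using skew_normal_form_invariants[OF T_skew[OF assms(1)]] unfolding N_def by blast
  have Q': "orthogonal_matrix (transpose Q)" using Q by simp
  have N: "N = transpose Q ** B ** transpose (transpose Q)"
    using orthogonal_conj_inverse[OF Q, of N] by (simp add: B)
  show "N \<in> T" "hamiltonian V U N = hamiltonian V U B"
    "inv_I (Lambda_of V U N) = inv_I (Lambda_of V U B)"
    unfolding N using orthogonal_conj_T[OF Q' assms(1)] hamiltonian_orthogonal_conj[OF Q' assms(1)]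
      inv_I_orthogonal_conj[OF Q'] by (simp_all only:)
qed

lemma ex_represents_hamiltonian: "\<exists>H. represents_hamiltonian V U T H"
  unfolding represents_hamiltonian_def
  \<comment> \<open>The witness evaluates the Hamiltonian at the normal form with the given
    invariants.\<close>
  by (rule exI[of _ "\<lambda>s p. hamiltonian V U (blk (major s p) (minor s p))"])
     (simp add: normal_form_in_T)

lemma V_has_derivative:
  assumes "x \<in> W"
  shows "(V has_real_derivative deriv V x) (at x)"
proof -
  have "C_k_on (Suc 0) UNIV W V"
    using V_smooth unfolding smooth_on_def by blast
  then obtain f' where "(V has_derivative f') (at x within W)"
    using assms by auto
  then have "V differentiable (at x)"
    using at_within_open[OF assms W_open] by (auto simp: differentiable_def)
  then show ?thesis
    by (simp add: DERIV_deriv_iff_real_differentiable)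
qed

lemma hamiltonian_has_derivative:
  assumes "B \<in> T"
  shows "(hamiltonian V U has_derivative (\<lambda>X. - ((Lambda_of V U B + (1/2) *\<^sub>R B) \<bullet> X))) (at B within T)"
proof -
  let ?L = "Lambda_of V U"
  have "C_k_on (Suc 0) skew T ?L"
    using diffeo unfolding diffeomorphism_on_def smooth_on_def Lambda_of_def by blast
  then obtain L' where L': "(?L has_derivative L') (at B within T)"
    using assms by auto
  have LU: "?L B \<in> U" by (rule Lambda_of_in[OF assms])
  have I': "((\<lambda>B. inv_I (?L B)) has_derivative (\<lambda>X. quartic_gradient (?L B) \<bullet> L' X)) (at B within T)"
    by (rule has_derivative_compose[OF L' inv_I_has_derivative[OF U_skew[OF LU]]])
  have "inv_I (?L B) \<in> W" using inv_I_U LU by blast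
  from has_derivative_compose[OF I' V_has_derivative[OF this, unfolded has_field_derivative_def]]
  have V': "((\<lambda>B. V (inv_I (?L B))) has_derivative
      (\<lambda>X. deriv V (inv_I (?L B)) * (quartic_gradient (?L B) \<bullet> L' X))) (at B within T)" .
  \<comment> \<open>This rearranges the definition of \<open>B\<close>. It makes the terms
    containing \<open>L'\<close>, the derivative of the inverse map, cancel below.\<close>
  have G: "deriv V (inv_I (?L B)) *\<^sub>R quartic_gradient (?L B) = ?L B + B"
    using B_map_Lambda_of[OF assms] by (simp add: B_map_skew_eq[OF U_skew[OF LU]] algebra_simps)
  have "((\<lambda>B. 1/4 * (B \<bullet> B) - 1/2 * ((?L B + B) \<bullet> (?L B + B)) + V (inv_I (?L B))) has_derivative
      (\<lambda>X. 1/4 * (B \<bullet> X + X \<bullet> B) - 1/2 * ((?L B + B) \<bullet> (L' X + X) + (L' X + X) \<bullet> (?L B + B))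
        + deriv V (inv_I (?L B)) * (quartic_gradient (?L B) \<bullet> L' X))) (at B within T)"
    by (intro has_derivative_add has_derivative_diff has_derivative_mult_right has_derivative_inner
        has_derivative_ident L' V')
  also have "(\<lambda>X. 1/4 * (B \<bullet> X + X \<bullet> B) - 1/2 * ((?L B + B) \<bullet> (L' X + X) + (L' X + X) \<bullet> (?L B + B))
        + deriv V (inv_I (?L B)) * (quartic_gradient (?L B) \<bullet> L' X))
      = (\<lambda>X. 1/2 * (B \<bullet> X) - (?L B + B) \<bullet> (L' X + X)
        + (deriv V (inv_I (?L B)) *\<^sub>R quartic_gradient (?L B)) \<bullet> L' X)"
    by (simp add: fun_eq_iff inner_commute[of _ B] inner_commute[of _ "?L B + B"])
  also have "\<dots> = (\<lambda>X. - ((?L B + (1/2) *\<^sub>R B) \<bullet> X))"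
    unfolding G by (simp add: fun_eq_iff inner_add_left inner_add_right)
  finally show ?thesis
    by (simp add: hamiltonian_def[abs_def] Let_def)
qed

text \<open>\<Lambda> commutes with its image \<open>blk \<alpha> \<beta>\<close>, so
  \<open>commute_blk\<close> makes it block diagonal as well; the two equations compare
  blocks.\<close>

lemma Lambda_of_blk:
  assumes "blk \<alpha> \<beta> \<in> T" "\<alpha> \<noteq> 0" "\<beta> \<noteq> 0" "\<alpha>\<^sup>2 \<noteq> \<beta>\<^sup>2"
  obtains a b where "Lambda_of V U (blk \<alpha> \<beta>) = blk a b"
    "\<alpha> = - a * (1 - 48 * deriv V (inv_I (blk a b)) * (a\<^sup>2 - b\<^sup>2))"
    "\<beta> = - b * (1 + 48 * deriv V (inv_I (blk a b)) * (a\<^sup>2 - b\<^sup>2))"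
proof -
  let ?L = "Lambda_of V U (blk \<alpha> \<beta>)"
  have L: "?L \<in> skew" by (rule U_skew[OF Lambda_of_in[OF assms(1)]])
  have B: "B_map V ?L = blk \<alpha> \<beta>" by (rule B_map_Lambda_of[OF assms(1)])
  have "?L ** blk \<alpha> \<beta> = blk \<alpha> \<beta> ** ?L"
    using B_map_commute[OF L, of V] by (simp add: B)
  then obtain a b where ab: "?L = blk a b"
    using commute_blk[OF L] assms by blast
  have inj: "x = x' \<and> y = y'" if "blk x y = blk x' y'" for x y x' y'
    using arg_cong[OF that, of "\<lambda>M. M$1$2"] arg_cong[OF that, of "\<lambda>M. M$3$4"] by (simp add: blk_def)
  show ?thesis
    using that[OF ab] inj[OF B[unfolded ab B_map_blk]] by simp
qed

lemma hamiltonian_blk: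
  assumes "Lambda_of V U (blk \<alpha> \<beta>) = blk a b"
  shows "hamiltonian V U (blk \<alpha> \<beta>)
    = (\<alpha>\<^sup>2 + \<beta>\<^sup>2) / 2 - ((a + \<alpha>)\<^sup>2 + (b + \<beta>)\<^sup>2) + V (inv_I (blk a b))"
proof -
  have "blk a b + blk \<alpha> \<beta> = blk (a + \<alpha>) (b + \<beta>)"
    by (simp add: vec_eq_iff blk_def)
  then show ?thesis
    by (simp add: hamiltonian_def assms inner_blk power2_eq_square field_simps)
qed

text \<open>Near \<open>(s, p)\<close>, \<open>H\<close> is the Hamiltonian composed with the
  section \<open>g\<close> of normal forms, so the chain rule applies.\<close>

lemma represents_hamiltonian_has_derivative:
  assumes H: "represents_hamiltonian V U T H" and B: "B \<in> T"
    and sp: "inv_p B < inv_s B" "0 < inv_p B"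
  defines "s \<equiv> inv_s B" and "p \<equiv> inv_p B"
  defines "\<alpha> \<equiv> major s p" and "\<beta> \<equiv> minor s p"
  assumes L: "Lambda_of V U (blk \<alpha> \<beta>) = blk a b"
  shows "((\<lambda>(x, y). H x y) has_derivative
     (\<lambda>h. - ((2 * a + \<alpha>) * ((\<alpha> * fst h - \<beta> * snd h) / (\<alpha>\<^sup>2 - \<beta>\<^sup>2))
       + (2 * b + \<beta>) * ((\<alpha> * snd h - \<beta> * fst h) / (\<alpha>\<^sup>2 - \<beta>\<^sup>2))))) (at (s, p))"
proof -
  define g where "g z = blk (major (fst z) (snd z)) (minor (fst z) (snd z))" for z
  have g': "(g has_derivative (\<lambda>h. blk ((\<alpha> * fst h - \<beta> * snd h) / (\<alpha>\<^sup>2 - \<beta>\<^sup>2))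
      ((\<alpha> * snd h - \<beta> * fst h) / (\<alpha>\<^sup>2 - \<beta>\<^sup>2)))) (at (s, p))"
    unfolding g_def \<alpha>_def \<beta>_def
    by (subst (1 2) blk_eq_scaleR)
       (intro has_derivative_add has_derivative_scaleR_left major_minor_has_derivative,
         use sp in \<open>simp_all add: s_def p_def\<close>)
  \<comment> \<open>\<open>T\<close> is open only relative to \<open>skew\<close>. An ambient open
    set \<open>O'\<close> is needed for its preimage under \<open>g\<close> to be open in the
    plane.\<close>
  obtain O' where O': "open O'" "T = skew \<inter> O'"
    using T_open by (auto simp: openin_open)
  define \<Omega> where "\<Omega> = {z. snd z < fst z \<and> 0 < snd z} \<inter> g -` O'"
  have "continuous_on UNIV g"
    unfolding g_def major_def minor_def
    by (subst blk_eq_scaleR) (intro continuous_intros; simp)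
  then have "open \<Omega>"
    unfolding \<Omega>_def using O'(1)
    by (intro open_Int open_Collect_conj open_Collect_less open_vimage continuous_intros)
  have g_T: "g z \<in> T" if "z \<in> \<Omega>" for z
    using that O'(2) by (auto simp: \<Omega>_def g_def blk_skew)
  have in\<Omega>: "(s, p) \<in> \<Omega>"
    using normal_form_in_T(1)[OF B] sp O'(2) by (simp add: \<Omega>_def g_def s_def p_def)
  have g_sp: "g (s, p) = blk \<alpha> \<beta>"
    by (simp add: g_def \<alpha>_def \<beta>_def)
  have "(hamiltonian V U has_derivative (\<lambda>X. - ((Lambda_of V U (g (s, p)) + (1/2) *\<^sub>R g (s, p)) \<bullet> X)))
      (at (g (s, p)) within g ` \<Omega>)"
    by (rule has_derivative_subset[OF hamiltonian_has_derivative[OF g_T[OF in\<Omega>]]]) (use g_T in blast)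
  moreover have "blk a b + (1/2) *\<^sub>R blk \<alpha> \<beta> = blk (a + \<alpha> / 2) (b + \<beta> / 2)"
    by (simp add: vec_eq_iff blk_def)
  ultimately have h': "(hamiltonian V U has_derivative (\<lambda>X. - (blk (a + \<alpha> / 2) (b + \<beta> / 2) \<bullet> X)))
      (at (g (s, p)) within g ` \<Omega>)"
    by (simp add: g_sp L)
  have "((\<lambda>z. hamiltonian V U (g z)) has_derivative
     (\<lambda>h. - ((2 * a + \<alpha>) * ((\<alpha> * fst h - \<beta> * snd h) / (\<alpha>\<^sup>2 - \<beta>\<^sup>2))
       + (2 * b + \<beta>) * ((\<alpha> * snd h - \<beta> * fst h) / (\<alpha>\<^sup>2 - \<beta>\<^sup>2))))) (at (s, p) within \<Omega>)"
    using has_derivative_in_compose[OF has_derivative_at_withinI[OF g'] h']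
    by (rule has_derivative_eq_rhs) (simp add: fun_eq_iff inner_blk algebra_simps)
  then have "((\<lambda>z. hamiltonian V U (g z)) has_derivative
     (\<lambda>h. - ((2 * a + \<alpha>) * ((\<alpha> * fst h - \<beta> * snd h) / (\<alpha>\<^sup>2 - \<beta>\<^sup>2))
       + (2 * b + \<beta>) * ((\<alpha> * snd h - \<beta> * fst h) / (\<alpha>\<^sup>2 - \<beta>\<^sup>2))))) (at (s, p))"
    using at_within_open[OF in\<Omega> \<open>open \<Omega>\<close>] by simp
  \<comment> \<open>On \<open>\<Omega>\<close> the matrix \<open>g z\<close> lies in
    \<open>T\<close> and has invariants \<open>z\<close>, so every representing \<open>H\<close>
    takes this value.\<close>
  moreover have "hamiltonian V U (g z) = (\<lambda>(x, y). H x y) z" if "z \<in> \<Omega>" for z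
  proof -
    have z: "snd z < fst z" "0 < snd z" using that by (simp_all add: \<Omega>_def)
    note mm = major_minor_eqs[OF z]
    have "inv_s (g z) = fst z" "inv_p (g z) = snd z"
      using mm z by (simp_all add: g_def inv_s_blk inv_p_blk)
    then show ?thesis
      using H g_T[OF that] by (simp add: represents_hamiltonian_def split_beta)
  qed
  ultimately show ?thesis
    by (rule has_derivative_transform_within_open[OF _ \<open>open \<Omega>\<close> in\<Omega>])
qed

lemma hamiltonian_identities:
  assumes H: "represents_hamiltonian V U T H" and B: "B \<in> T"
    and sp: "inv_p B < inv_s B" "0 < inv_p B"
  defines "s \<equiv> inv_s B" and "p \<equiv> inv_p B"
  defines "Hs \<equiv> deriv (\<lambda>x. H x p) s" and "Hp \<equiv> deriv (\<lambda>y. H s y) p"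
    and "I \<equiv> inv_I (Lambda_of V U B)"
  shows "(\<lambda>(x, y). H x y) differentiable at (s, p)"
    and "2 * I * deriv V I - V I = s * Hs + p * Hp - H s p"
    and "(s\<^sup>2 - p\<^sup>2) / p * Hs * Hp = - 2 * I * deriv V I"
    and "I = 6 * (s\<^sup>2 - p\<^sup>2) * (Hp\<^sup>2 - (1 + Hs)\<^sup>2)\<^sup>2"
proof -
  define \<alpha> \<beta> where "\<alpha> = major s p" and "\<beta> = minor s p"
  note mm = major_minor_eqs[OF sp, folded s_def p_def, folded \<alpha>_def \<beta>_def]
  note N = normal_form_in_T[OF B, folded s_def p_def, folded \<alpha>_def \<beta>_def]
  have d: "\<alpha>\<^sup>2 - \<beta>\<^sup>2 \<noteq> 0"
    using mm(3,4) power_strict_mono[of \<beta> \<alpha> 2] by simp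
  obtain a b where L: "Lambda_of V U (blk \<alpha> \<beta>) = blk a b"
    and \<alpha>: "\<alpha> = - a * (1 - 48 * deriv V (inv_I (blk a b)) * (a\<^sup>2 - b\<^sup>2))"
    and \<beta>: "\<beta> = - b * (1 + 48 * deriv V (inv_I (blk a b)) * (a\<^sup>2 - b\<^sup>2))"
    using Lambda_of_blk[OF N(1)] mm(3,4) d by auto
  have I: "I = inv_I (blk a b)"
    using N(3) by (simp add: I_def L)
  note D = represents_hamiltonian_has_derivative[OF H B sp, folded s_def p_def, folded \<alpha>_def \<beta>_def, OF L]
  show "(\<lambda>(x, y). H x y) differentiable at (s, p)"
    using D unfolding differentiable_def by blast
  have Hs: "Hs = ((2 * b + \<beta>) * \<beta> - (2 * a + \<alpha>) * \<alpha>) / (\<alpha>\<^sup>2 - \<beta>\<^sup>2)"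
    and Hp: "Hp = ((2 * a + \<alpha>) * \<beta> - (2 * b + \<beta>) * \<alpha>) / (\<alpha>\<^sup>2 - \<beta>\<^sup>2)"
  proof -
    \<comment> \<open>The denominator is made opaque so that simplification treats it as a single
      nonzero factor.\<close>
    obtain e where e: "\<alpha>\<^sup>2 - \<beta>\<^sup>2 = e" by blast
    show "Hs = ((2 * b + \<beta>) * \<beta> - (2 * a + \<alpha>) * \<alpha>) / (\<alpha>\<^sup>2 - \<beta>\<^sup>2)"
      "Hp = ((2 * a + \<alpha>) * \<beta> - (2 * b + \<beta>) * \<alpha>) / (\<alpha>\<^sup>2 - \<beta>\<^sup>2)"
      unfolding Hs_def Hp_def partial_derivatives[OF D] e using d e by (simp_all add: field_simps)
  qed
  have h: "H s p = s - ((a + \<alpha>)\<^sup>2 + (b + \<beta>)\<^sup>2) + V I"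
    using H B N(2) hamiltonian_blk[OF L] mm(1) by (simp add: represents_hamiltonian_def I s_def p_def)
  \<comment> \<open>Oriented towards the short names, these equations collapse the abbreviations
    expanded in instances of \<open>legendre_algebra\<close>.\<close>
  have \<alpha>': "- a * (1 - 48 * deriv V I * (a\<^sup>2 - b\<^sup>2)) = \<alpha>"
    and \<beta>': "- b * (1 + 48 * deriv V I * (a\<^sup>2 - b\<^sup>2)) = \<beta>"
    using \<alpha> \<beta> by (simp_all only: I)
  have I': "24 * (a\<^sup>2 - b\<^sup>2)\<^sup>2 = I" by (simp add: I inv_I_blk)
  have "\<alpha> * \<beta> \<noteq> 0" using mm(2) sp by (simp add: p_def)
  note * = legendre_algebra(1)[of a "deriv V I" b Hs Hp "V I", unfolded \<alpha>' \<beta>' I' mm(1,2), folded h,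
      OF d _ Hs Hp]
    legendre_algebra(2,3)[of a "deriv V I" b Hs Hp, unfolded \<alpha>' \<beta>' I' mm(1,2), OF d _ Hs Hp]
  show "2 * I * deriv V I - V I = s * Hs + p * Hp - H s p"
    "(s\<^sup>2 - p\<^sup>2) / p * Hs * Hp = - 2 * I * deriv V I"
    "I = 6 * (s\<^sup>2 - p\<^sup>2) * (Hp\<^sup>2 - (1 + Hs)\<^sup>2)\<^sup>2"
    using * sp(2) by (simp_all add: p_def)
qed

end

text \<open>\<open>H\<close> is constrained only at invariants of points of \<open>T\<close>, hence
  the quantification over all representing functions. The existence clause excludes vacuity, and
  differentiability makes the values of \<open>deriv\<close> genuine partial derivatives.\<close>

theorem mainTheorem7:
  fixes U T :: "(real^5^5) set" and W :: "real set" and V :: "real \<Rightarrow> real"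
  assumes "openin (top_of_set skew) U"
    and "orthogonally_invariant U"
    and "open W" and "inv_I ` U \<subseteq> W"
    and "smooth_on UNIV W V"
    and "diffeomorphism_on skew U T (B_map V)"
  shows "(\<exists>H. represents_hamiltonian V U T H) \<and>
    (\<forall>H. represents_hamiltonian V U T H \<longrightarrow>
      (\<forall>B\<in>T. inv_s B > inv_p B \<and> inv_p B > 0 \<longrightarrow>
        (let s = inv_s B; p = inv_p B;
             Hs = deriv (\<lambda>x. H x p) s; Hp = deriv (\<lambda>y. H s y) p;
             I = inv_I (Lambda_of V U B); V_I = deriv V I
         in (\<lambda>(x, y). H x y) differentiable at (s, p) \<and>
            2 * I * V_I - V I = s * Hs + p * Hp - H s p \<and>
            (s\<^sup>2 - p\<^sup>2) / p * Hs * Hp = - 2 * I * V_I \<and>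
            V I = H s p - (s * Hs + p * Hp) - (s\<^sup>2 - p\<^sup>2) / p * Hs * Hp \<and>
            I = 6 * (s\<^sup>2 - p\<^sup>2) * (Hp\<^sup>2 - (1 + Hs)\<^sup>2)\<^sup>2)))"
proof -
  interpret duality_map U T W V
    by unfold_locales (fact assms)+
  show ?thesis
    unfolding Let_def
  proof (intro conjI allI ballI impI ex_represents_hamiltonian)
    fix H B
    assume "represents_hamiltonian V U T H" "B \<in> T" "inv_p B < inv_s B \<and> 0 < inv_p B"
    then have "represents_hamiltonian V U T H" "B \<in> T" "inv_p B < inv_s B" "0 < inv_p B"
      by simp_all
    note * = hamiltonian_identities[OF this]
    show "(\<lambda>(x, y). H x y) differentiable at (inv_s B, inv_p B)" by (rule *(1))
    show 2: "2 * inv_I (Lambda_of V U B) * deriv V (inv_I (Lambda_of V U B)) - V (inv_I (Lambda_of V U B))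
      = inv_s B * deriv (\<lambda>x. H x (inv_p B)) (inv_s B) + inv_p B * deriv (H (inv_s B)) (inv_p B)
        - H (inv_s B) (inv_p B)"
      by (rule *(2))
    show 3: "((inv_s B)\<^sup>2 - (inv_p B)\<^sup>2) / inv_p B * deriv (\<lambda>x. H x (inv_p B)) (inv_s B)
        * deriv (H (inv_s B)) (inv_p B)
      = - 2 * inv_I (Lambda_of V U B) * deriv V (inv_I (Lambda_of V U B))"
      by (rule *(3))
    \<comment> \<open>Inserting the second identity leaves a rearrangement of the first.\<close>
    show "V (inv_I (Lambda_of V U B)) = H (inv_s B) (inv_p B)
      - (inv_s B * deriv (\<lambda>x. H x (inv_p B)) (inv_s B) + inv_p B * deriv (H (inv_s B)) (inv_p B))
      - ((inv_s B)\<^sup>2 - (inv_p B)\<^sup>2) / inv_p B * deriv (\<lambda>x. H x (inv_p B)) (inv_s B)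
        * deriv (H (inv_s B)) (inv_p B)"
      unfolding 3 using 2 by simp
    show "inv_I (Lambda_of V U B) = 6 * ((inv_s B)\<^sup>2 - (inv_p B)\<^sup>2)
      * ((deriv (H (inv_s B)) (inv_p B))\<^sup>2 - (1 + deriv (\<lambda>x. H x (inv_p B)) (inv_s B))\<^sup>2)\<^sup>2"
      by (rule *(4))
  qed
qed

end
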